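(* Let $\alpha\in[0,1)$, $\varepsilon\in(0,1)$ and $\gamma\in(0,1-\alpha]$ be fixed constants. There exists a constant $\xi=\xi(\alpha,\varepsilon,\gamma)>0$ such that for every sequence of inverse temperatures $\beta=\beta_n$ with $\beta_n=\omega(\log n)$ (i.e. $\beta_n/\log n\to+\infty$), with probability $1-o(1)$ as $n\to\infty$ over the random graph $G\sim\mathcal{G}(n,\frac12,k=\lfloor n^\alpha\rfloor)$ with planted clique $\mathcal{PC}$, the following holds. For every clique $C\in\Omega(G)$ of size at most $\xi\log n$ and every constant $c\in\mathbb{N}$, $c\ge 1$, with probability at least $1-n^{-\omega(1)}$ the Metropolis process on $G$ with stationary distribution $\pi_\beta(C')\propto\exp(\beta|C'|)$, $C'\in\Omega(G)$ (the Gibbs measure for the identity function $h_q=q$), started from $C$, will not reach within $n^c$ steps (i) either a clique of size at least $(1+\varepsilon)\log n$, (ii) or a clique of intersection at least $\gamma\log n$ with the planted clique.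
   Context: Conventions: $\log$ is the base-2 logarithm. $n^{-\omega(1)}$ denotes a quantity that is at most $n^{-D}$ for every constant $D>0$ once $n$ is large enough; it does not depend on the choice of $C$. Planted clique model: $\mathcal{G}(n,\frac12,k)$ is the random graph on an $n$-element vertex set $V$ obtained by sampling $\mathcal{G}(n,\frac12)$ (each pair is an edge independently with probability $1/2$), choosing a uniformly random $k$-subset $\mathcal{PC}\subseteq V$ (the planted clique), and adding all edges between vertices of $\mathcal{PC}$. $\Omega(G)$ denotes the set of all cliques of $G$, i.e. vertex subsets (including $\emptyset$) whose vertices are pairwise adjacent. Metropolis process (for $h_q=q$): the Markov chain $\{X_t\}$ on $\Omega(G)$ which at step $t$ picks $v\in V$ uniformly at random and sets $C'=X_{t-1}\oplus\{v\}$ (symmetric difference). If $C'\in\Omega(G)$, then $X_t=C'$ with probability $\min\{1,\exp(\beta(|C'|-|X_{t-1}|))\}$ and $X_t=X_{t-1}$ otherwise. If $C'\notin\Omega(G)$, then $X_t=X_{t-1}$. *)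

theory Defs
  imports "HOL-Probability.Probability" "HOL-Library.Ramsey"
begin

text \<open>
  Graphs have vertex set \<open>{..<n}\<close> and are given by their set of edges, a subset of
  \<open>nsets {..<n} 2\<close>, the two-element subsets of the vertex set.
\<close>

definition cliques :: "nat \<Rightarrow> nat set set \<Rightarrow> nat set set" where
  "cliques n E = {C. C \<subseteq> {..<n} \<and> clique C E}"

definition gnp_half :: "nat \<Rightarrow> nat set set pmf" where
  "gnp_half n =
     map_pmf (\<lambda>f. {e \<in> nsets {..<n} 2. f e})
       (Pi_pmf (nsets {..<n} 2) False (\<lambda>_. bernoulli_pmf (1 / 2)))"

text \<open>
  The joint law of the graph and its planted clique. It is meant for \<open>k \<le> n\<close>;
  otherwise there is no \<open>k\<close>-subset to choose from.
\<close>

definition planted_clique :: "nat \<Rightarrow> nat \<Rightarrow> (nat set set \<times> nat set) pmf" where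
  "planted_clique n k = do {
     E \<leftarrow> gnp_half n;
     PC \<leftarrow> pmf_of_set {S. S \<subseteq> {..<n} \<and> card S = k};
     return_pmf (E \<union> nsets PC 2, PC)
   }"

text \<open>The Metropolis chain is meant for \<open>n > 0\<close>, when there is a vertex to pick.\<close>

definition metropolis :: "nat \<Rightarrow> nat set set \<Rightarrow> real \<Rightarrow> nat set \<Rightarrow> nat set pmf" where
  "metropolis n E \<beta> X = do {
     v \<leftarrow> pmf_of_set {..<n};
     let C' = sym_diff X {v};
     if C' \<in> cliques n E then do {
       accept \<leftarrow> bernoulli_pmf (min 1 (exp (\<beta> * (real (card C') - real (card X)))));
       return_pmf (if accept then C' else X)
     } else return_pmf X
   }"

text \<open>The law of the path \<open>[X\<^sub>0, \<dots>, X\<^sub>T]\<close> of the chain with kernel \<open>K\<close> and \<open>X\<^sub>0 = x\<close>.\<close>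

primrec trajectory :: "('s \<Rightarrow> 's pmf) \<Rightarrow> nat \<Rightarrow> 's \<Rightarrow> 's list pmf" where
  "trajectory K 0 x = return_pmf [x]"
| "trajectory K (Suc T) x = do {
     y \<leftarrow> K x;
     path \<leftarrow> trajectory K T y;
     return_pmf (x # path)
   }"

definition reach_prob :: "('s \<Rightarrow> 's pmf) \<Rightarrow> 's \<Rightarrow> nat \<Rightarrow> 's set \<Rightarrow> real" where
  "reach_prob K x T A = measure_pmf.prob (trajectory K T x) {path. \<exists>y\<in>set path. y \<in> A}"

text \<open>\<open>\<delta> n = n\<^bsup>-\<omega>(1)\<^esup>\<close>\<close>

definition superpoly_small :: "(nat \<Rightarrow> real) \<Rightarrow> bool" where
  "superpoly_small \<delta> \<longleftrightarrow> (\<forall>D>0. \<forall>\<^sub>F n in sequentially. \<delta> n \<le> real n powr (-D))"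

text \<open>
  The Gibbs measure \<open>\<pi>\<^sub>\<beta>\<close>. It does not enter the transition rule explicitly; that it is
  stationary for the chain is proved below.
\<close>

definition gibbs :: "nat \<Rightarrow> nat set set \<Rightarrow> real \<Rightarrow> nat set pmf" where
  "gibbs n E \<beta> = embed_pmf (\<lambda>C. if C \<in> cliques n E
     then exp (\<beta> * real (card C)) / (\<Sum>C'\<in>cliques n E. exp (\<beta> * real (card C'))) else 0)"

lemma finite_cliques [simp]: "finite (cliques n E)"
  by (rule finite_subset[of _ "Pow {..<n}"]) (auto simp: cliques_def)

lemma empty_in_cliques [simp]: "{} \<in> cliques n E"
  by (simp add: cliques_def)

lemma pmf_gibbs:
  "pmf (gibbs n E \<beta>) C = (if C \<in> cliques n E
     then exp (\<beta> * real (card C)) / (\<Sum>C'\<in>cliques n E. exp (\<beta> * real (card C'))) else 0)"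
proof -
  let ?w = "\<lambda>C. exp (\<beta> * real (card C))"
  let ?Z = "\<Sum>C'\<in>cliques n E. ?w C'"
  let ?p = "\<lambda>C. if C \<in> cliques n E then ?w C / ?Z else 0"
  have Z: "?Z > 0"
    by (rule sum_pos2[of _ "{}"]) auto
  have "(\<integral>\<^sup>+C. ennreal (?p C) \<partial>count_space UNIV)
      = (\<Sum>C\<in>cliques n E. ennreal (?p C))"
    by (rule nn_integral_count_space') auto
  also have "\<dots> = ennreal (\<Sum>C\<in>cliques n E. ?p C)"
    using Z by (intro sum_ennreal) (auto intro!: divide_nonneg_pos)
  also have "(\<Sum>C\<in>cliques n E. ?p C) = (\<Sum>C\<in>cliques n E. ?w C / ?Z)"
    by (intro sum.cong) auto
  also have "\<dots> = 1"
    using Z by (simp flip: sum_divide_distrib)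
  finally show ?thesis
    unfolding gibbs_def using Z by (subst pmf_embed_pmf) (auto intro!: divide_nonneg_pos)
qed

lemma pmf_metropolis_off_diagonal:
  assumes "n > 0" "X \<noteq> Y" "Y \<in> cliques n E"
  shows "pmf (metropolis n E \<beta> X) Y =
    (\<Sum>v<n. if sym_diff X {v} = Y
            then min 1 (exp (\<beta> * (real (card Y) - real (card X)))) else 0) / real n"
proof -
  have ne: "{..<n} \<noteq> {}" using assms by auto
  have *: "pmf (bernoulli_pmf p \<bind> (\<lambda>b. return_pmf (if b then C else X))) Y
      = (if C = Y then p else 0)"
    if "0 \<le> p" "p \<le> 1" for p :: real and C
    using that assms by (simp add: pmf_bind indicator_def)
  have step: "pmf (if C \<in> cliques n E then
        bernoulli_pmf (min 1 (exp (\<beta> * (real (card C) - real (card X)))))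
          \<bind> (\<lambda>b. return_pmf (if b then C else X)) else return_pmf X) Y
      = (if C = Y then min 1 (exp (\<beta> * (real (card Y) - real (card X)))) else 0)" for C
  proof (cases "C \<in> cliques n E")
    case True
    show ?thesis
      unfolding if_P[OF True] by (subst *) simp_all
  next
    case False
    then show ?thesis using assms by auto
  qed
  show ?thesis
    unfolding metropolis_def Let_def
    by (subst pmf_bind_pmf_of_set[OF ne finite_lessThan]) (simp only: step card_lessThan)
qed

lemma metropolis_detailed_balance:
  assumes "n > 0" "X \<in> cliques n E" "Y \<in> cliques n E"
  shows "pmf (gibbs n E \<beta>) X * pmf (metropolis n E \<beta> X) Y =
         pmf (gibbs n E \<beta>) Y * pmf (metropolis n E \<beta> Y) X"
proof (cases "X = Y")
  case False
  let ?x = "\<beta> * real (card X)" and ?y = "\<beta> * real (card Y)"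
  have swap: "sym_diff X {v} = Y \<longleftrightarrow> sym_diff Y {v} = X" for v
    by auto
  have m: "exp ?x * min 1 (exp (?y - ?x)) = exp ?y * min 1 (exp (?x - ?y))"
    by (auto simp: min_def exp_diff)
  define N where "N = (\<Sum>v<n. if sym_diff X {v} = Y then 1 else (0::real))"
  have "(\<Sum>v<n. if sym_diff X {v} = Y then c else 0) = c * N" for c :: real
    by (simp add: N_def sum_distrib_left if_distrib cong: if_cong)
  moreover have "(\<Sum>v<n. if sym_diff Y {v} = X then c else 0) = c * N" for c :: real
    unfolding swap[symmetric] by (simp add: N_def sum_distrib_left if_distrib cong: if_cong)
  ultimately show ?thesis
    using assms False m
    by (simp add: pmf_metropolis_off_diagonal pmf_gibbs right_diff_distrib)
qed simp

theorem gibbs_stationary: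
  assumes "n > 0"
  shows "bind_pmf (gibbs n E \<beta>) (metropolis n E \<beta>) = gibbs n E \<beta>"
proof (rule pmf_eqI)
  fix Y
  have ne: "{..<n} \<noteq> {}" using assms by auto
  have closed: "set_pmf (metropolis n E \<beta> X) \<subseteq> cliques n E" if "X \<in> cliques n E" for X
    using that unfolding metropolis_def Let_def
    by (auto simp: set_pmf_of_set[OF ne] split: if_splits)
  have "pmf (bind_pmf (gibbs n E \<beta>) (metropolis n E \<beta>)) Y =
      (\<Sum>X\<in>cliques n E. pmf (gibbs n E \<beta>) X * pmf (metropolis n E \<beta> X) Y)"
    unfolding pmf_bind
    by (subst integral_measure_pmf[of "cliques n E"])
       (auto simp: set_pmf_eq pmf_gibbs split: if_splits)
  also have "\<dots> = pmf (gibbs n E \<beta>) Y"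
  proof (cases "Y \<in> cliques n E")
    case True
    have "(\<Sum>X\<in>cliques n E. pmf (gibbs n E \<beta>) X * pmf (metropolis n E \<beta> X) Y)
        = (\<Sum>X\<in>cliques n E. pmf (gibbs n E \<beta>) Y * pmf (metropolis n E \<beta> Y) X)"
      using assms True by (intro sum.cong refl metropolis_detailed_balance)
    also have "\<dots> = pmf (gibbs n E \<beta>) Y * (\<Sum>X\<in>cliques n E. pmf (metropolis n E \<beta> Y) X)"
      by (simp add: sum_distrib_left)
    also have "(\<Sum>X\<in>cliques n E. pmf (metropolis n E \<beta> Y) X) = 1"
      using closed[OF True] by (intro sum_pmf_eq_1) auto
    finally show ?thesis by simp
  next
    case False
    then have "pmf (metropolis n E \<beta> X) Y = 0" if "X \<in> cliques n E" for X
      using closed[OF that] by (auto simp: set_pmf_eq)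
    with False show ?thesis by (simp add: pmf_gibbs)
  qed
  finally show "pmf (bind_pmf (gibbs n E \<beta>) (metropolis n E \<beta>)) Y = pmf (gibbs n E \<beta>) Y" .
qed

end

theory Submission
  imports Defs "HOL-Real_Asymp.Real_Asymp"
begin

text \<open>
  At temperature \<open>\<beta> = \<omega>(log n)\<close> a removal is accepted with probability at most
  \<open>e\<^sup>-\<^sup>\<beta>\<close>, so within polynomially many steps the process only adds vertices, each uniform
  among the current common neighbours. Let \<open>L = log n\<close>. Uniformly over all cliques of size
  \<open>l < (1 - \<theta>) L\<close> there are at least \<open>n\<^sup>1\<^sup>-\<^sup>\<theta> / 2\<^sup>l\<close> common neighbours, already in
  \<open>G(n, 1/2)\<close>. Hence a fixed target clique \<open>K\<close> is reached with probability at most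
  \<open>|K|!\<close> times the product of the inverses of these numbers. It remains to sum over the cliques
  \<open>K\<close> at which the process can first be in the bad set, those with \<open>|K| = \<lceil>(1 + \<epsilon>) L\<rceil>\<close>
  or \<open>|K \<inter> PC| = \<lceil>\<gamma> L\<rceil>\<close>. By the first moment method this sum is at most
  \<open>2\<close> to the power \<open>-6 \<theta> L\<^sup>2\<close>, up to lower-order factors. Starting from a clique of size
  at most \<open>\<theta> L\<close> instead of the empty one costs only a factor \<open>2\<close> to the power
  \<open>\<theta> L\<^sup>2\<close>.
\<close>

section \<open>The Metropolis chain as an addition process\<close>

lemma prob_bind_pmf:
  "measure_pmf.prob (p \<bind> f) A = measure_pmf.expectation p (\<lambda>x. measure_pmf.prob (f x) A)"
proof -
  have "ennreal (measure_pmf.prob (p \<bind> f) A) = (\<integral>\<^sup>+x. ennreal (measure_pmf.prob (f x) A) \<partial>measure_pmf p)"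
    by (simp flip: measure_pmf.emeasure_eq_measure)
  also have "\<dots> = ennreal (measure_pmf.expectation p (\<lambda>x. measure_pmf.prob (f x) A))"
    by (intro nn_integral_eq_integral measure_pmf.integrable_const_bound[where B = 1]) auto
  finally show ?thesis
    by (simp add: integral_nonneg_AE)
qed

lemma reach_prob_nonneg: "0 \<le> reach_prob K x T A"
  by (simp add: reach_prob_def)

lemma reach_prob_le_1: "reach_prob K x T A \<le> 1"
  by (simp add: reach_prob_def)

lemma reach_prob_0: "x \<notin> A \<Longrightarrow> reach_prob K x 0 A = 0"
  by (simp add: reach_prob_def)

lemma reach_prob_Suc:
  assumes "x \<notin> A"
  shows "reach_prob K x (Suc T) A = measure_pmf.expectation (K x) (\<lambda>y. reach_prob K y T A)"
proof -
  have "measure_pmf.prob (trajectory K T y \<bind> (\<lambda>path. return_pmf (x # path)))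
      {path. \<exists>y\<in>set path. y \<in> A} = reach_prob K y T A" for y
    using assms unfolding reach_prob_def map_pmf_def[symmetric]
    by (simp add: vimage_def)
  then show ?thesis
    by (simp add: reach_prob_def[of K x "Suc T"] prob_bind_pmf)
qed

section \<open>One step of the chain in terms of clique extensions\<close>

lemma cliques_subset: "K \<in> cliques n E \<Longrightarrow> X \<subseteq> K \<Longrightarrow> X \<in> cliques n E"
  by (auto simp: cliques_def clique_def)

lemma finite_clique: "X \<in> cliques n E \<Longrightarrow> finite X"
  by (auto simp: cliques_def intro: finite_subset[OF _ finite_lessThan])

definition extensions :: "nat \<Rightarrow> nat set set \<Rightarrow> nat set \<Rightarrow> nat set" where
  "extensions n E X = {v \<in> {..<n} - X. insert v X \<in> cliques n E}"

lemma finite_extensions [simp]: "finite (extensions n E X)"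
  by (simp add: extensions_def)

lemma card_extensions_le: "card (extensions n E X) \<le> n"
  using card_mono[of "{..<n}" "extensions n E X"] by (auto simp: extensions_def)

text \<open>Picking a vertex of \<open>X\<close> proposes a removal, accepted with probability
  \<open>exp (- \<beta>)\<close> and charged in full because \<open>h \<le> 1\<close>. Picking an
  extension always succeeds, and any other vertex leaves \<open>X\<close> in place. Removals thus
  enter only through the additive error, and nothing need be known about the states they lead
  to.\<close>

lemma expectation_metropolis_le:
  assumes "n > 0" "X \<in> cliques n E" "\<beta> \<ge> 0" and h: "\<And>Y. 0 \<le> h Y" "\<And>Y. h Y \<le> (1::real)"
  shows "measure_pmf.expectation (metropolis n E \<beta> X) h \<le>
    exp (- \<beta>) + ((\<Sum>v\<in>extensions n E X. h (insert v X)) +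
      (real n - real (card (extensions n E X))) * h X) / real n"
proof -
  let ?A = "extensions n E X"
  define step where "step = (\<lambda>v. let C' = sym_diff X {v} in
     if C' \<in> cliques n E then
       bernoulli_pmf (min 1 (exp (\<beta> * (real (card C') - real (card X))))) \<bind>
        (\<lambda>accept. return_pmf (if accept then C' else X))
     else return_pmf X)"
  have finX: "finite X"
    using assms(2) by (rule finite_clique)
  have fin: "finite (set_pmf (step v))" for v
    by (auto simp: step_def Let_def)
  have step: "measure_pmf.expectation (step v) h \<le>
      (if v \<in> ?A then h (insert v X) else exp (- \<beta>) + h X)" if "v < n" for v
  proof (cases "v \<in> X")
    case True
    have C': "sym_diff X {v} = X - {v}" using True by auto
    have "X - {v} \<in> cliques n E"
      using assms(2) by (rule cliques_subset) auto
    moreover have "real (card (X - {v})) - real (card X) = - 1"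
      using True finX card_gt_0_iff[of X] by (subst card_Diff_singleton) (auto simp: of_nat_diff)
    moreover have "min 1 (exp (- \<beta>)) = exp (- \<beta>)"
      using assms(3) by simp
    ultimately have "step v = bernoulli_pmf (exp (- \<beta>)) \<bind>
        (\<lambda>accept. return_pmf (if accept then X - {v} else X))"
      unfolding step_def Let_def C' by simp
    also have "measure_pmf.expectation \<dots> h =
        exp (- \<beta>) * h (X - {v}) + (1 - exp (- \<beta>)) * h X"
      using assms(3) by (subst pmf_expectation_bind[where A = UNIV]) (auto simp: UNIV_bool)
    also have "\<dots> \<le> exp (- \<beta>) * 1 + 1 * h X"
      using h by (intro add_mono mult_mono mult_left_mono) auto
    finally show ?thesis using True by (simp add: extensions_def)
  next
    case False
    have C': "sym_diff X {v} = insert v X" using False by auto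
    show ?thesis
    proof (cases "insert v X \<in> cliques n E")
      case True
      have c: "real (card (insert v X)) - real (card X) = 1"
        using False finX by simp
      have "min 1 (exp (\<beta> * (real (card (insert v X)) - real (card X)))) = 1"
        unfolding c using assms(3) by simp
      moreover have "bernoulli_pmf 1 = return_pmf True"
        by (intro pmf_eqI) (auto split: split_indicator simp: pmf_return)
      ultimately have "step v = return_pmf (insert v X)"
        using True by (simp add: step_def Let_def C' bind_return_pmf)
      then show ?thesis
        using True False that by (simp add: extensions_def)
    next
      case False2: False
      then have "step v = return_pmf X"
        by (simp add: step_def Let_def C')
      then show ?thesis
        using False2 by (simp add: extensions_def)
    qed
  qed
  have "metropolis n E \<beta> X = pmf_of_set {..<n} \<bind> step"
    by (simp only: metropolis_def step_def)
  then have "measure_pmf.expectation (metropolis n E \<beta> X) h =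
      (\<Sum>v<n. measure_pmf.expectation (step v) h) / real n"
    using assms(1) fin by (simp add: pmf_expectation_bind_pmf_of_set lessThan_empty_iff
        divide_inverse sum_distrib_left mult.commute)
  also have "\<dots> \<le> (\<Sum>v<n. if v \<in> ?A then h (insert v X) else exp (- \<beta>) + h X) / real n"
    by (intro divide_right_mono sum_mono step) auto
  also have "(\<Sum>v<n. if v \<in> ?A then h (insert v X) else exp (- \<beta>) + h X) =
      (\<Sum>v\<in>?A. h (insert v X)) + (\<Sum>v\<in>{..<n} - ?A. exp (- \<beta>) + h X)"
    unfolding sum.If_cases[OF finite_lessThan] Collect_mem_eq
    by (intro arg_cong2[where f = "(+)"] sum.cong) (auto simp: extensions_def)
  also have "(\<Sum>v\<in>{..<n} - ?A. exp (- \<beta>) + h X) = (real n - real (card ?A)) * (exp (- \<beta>) + h X)"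
    using card_extensions_le[of n E X]
    by (subst sum_constant, subst card_Diff_subset) (auto simp: extensions_def of_nat_diff)
  also have "\<dots> \<le> real n * exp (- \<beta>) + (real n - real (card ?A)) * h X"
    by (simp add: algebra_simps)
  finally show ?thesis using assms(1) by (simp add: divide_simps algebra_simps)
qed

text \<open>
  If every clique of size \<open>l\<close> has at least \<open>1 / b l\<close> extensions, or none, this bounds the
  probability that the addition process, started from an \<open>i\<close>-subset of a \<open>k\<close>-clique, ever equals
  that clique.
\<close>

definition addition_weight :: "(nat \<Rightarrow> real) \<Rightarrow> nat \<Rightarrow> nat \<Rightarrow> real" where
  "addition_weight b i k = (\<Prod>l\<in>{i..<k}. real (k - l) * b l)"

definition potential :: "(nat \<Rightarrow> real) \<Rightarrow> nat set set \<Rightarrow> nat set \<Rightarrow> real" where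
  "potential b KK X = (\<Sum>K\<in>{K\<in>KK. X \<subseteq> K}. addition_weight b (card X) (card K))"

lemma addition_weight_nonneg: "(\<And>l. 0 \<le> b l) \<Longrightarrow> 0 \<le> addition_weight b i k"
  by (auto simp: addition_weight_def intro!: prod_nonneg mult_nonneg_nonneg)

text \<open>Double counting: a target \<open>K\<close> containing \<open>X\<close> contributes once
  for each vertex of \<open>K - X\<close>, and every such vertex is an extension. Adding a vertex
  drops the factor \<open>(card K - l) * b l\<close>, \<open>l = card X\<close>, from the weight.
  Here \<open>card K - l\<close> matches the number of contributions, and \<open>b l\<close> times
  the number of extensions is at least 1.\<close>

lemma potential_superharmonic:
  assumes KK: "KK \<subseteq> cliques n E" and X: "X \<in> cliques n E"
    and b: "\<And>l. 0 \<le> b l" "extensions n E X \<noteq> {} \<Longrightarrow> 1 \<le> real (card (extensions n E X)) * b (card X)"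
  shows "(\<Sum>v\<in>extensions n E X. potential b KK (insert v X)) \<le>
    real (card (extensions n E X)) * potential b KK X"
proof (cases "extensions n E X = {}")
  case False
  let ?A = "extensions n E X" and ?w = "addition_weight b"
  have finX: "finite X"
    using X by (rule finite_clique)
  have finKK: "finite KK"
    using KK finite_subset finite_cliques by blast
  have finK: "finite K" if "K \<in> KK" for K
    using KK that finite_clique by blast
  have sub: "v \<in> ?A" if "K \<in> KK" "X \<subseteq> K" "v \<in> K - X" for K v
  proof -
    have "K \<in> cliques n E" using that KK by auto
    moreover from this have "insert v X \<in> cliques n E"
      by (rule cliques_subset) (use that in auto)
    ultimately show ?thesis
      using that by (auto simp: extensions_def cliques_def)
  qed
  have "(\<Sum>v\<in>?A. potential b KK (insert v X)) =
      (\<Sum>v\<in>?A. \<Sum>K\<in>{K\<in>KK. X \<subseteq> K}. if v \<in> K then ?w (Suc (card X)) (card K) else 0)"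
    unfolding potential_def
  proof (rule sum.cong[OF refl])
    fix v assume v: "v \<in> ?A"
    then have "card (insert v X) = Suc (card X)"
      using finX by (simp add: extensions_def)
    moreover have "{K\<in>KK. insert v X \<subseteq> K} = {K\<in>KK. X \<subseteq> K} \<inter> {K. v \<in> K}"
      by auto
    ultimately show "(\<Sum>K\<in>{K\<in>KK. insert v X \<subseteq> K}. ?w (card (insert v X)) (card K)) =
      (\<Sum>K\<in>{K\<in>KK. X \<subseteq> K}. if v \<in> K then ?w (Suc (card X)) (card K) else 0)"
      using finKK by (simp add: sum.If_cases)
  qed
  also have "\<dots> = (\<Sum>K\<in>{K\<in>KK. X \<subseteq> K}. \<Sum>v\<in>?A. if v \<in> K then ?w (Suc (card X)) (card K) else 0)"
    by (rule sum.swap)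
  also have "\<dots> \<le> (\<Sum>K\<in>{K\<in>KK. X \<subseteq> K}. real (card ?A) * ?w (card X) (card K))"
  proof (intro sum_mono)
    fix K assume K: "K \<in> {K\<in>KK. X \<subseteq> K}"
    have "?A \<inter> K = K - X"
      using sub K by (auto simp: extensions_def)
    then have "(\<Sum>v\<in>?A. if v \<in> K then ?w (Suc (card X)) (card K) else 0) =
        real (card K - card X) * ?w (Suc (card X)) (card K)"
      using K finX by (simp add: sum.If_cases Collect_mem_eq card_Diff_subset)
    also have "\<dots> \<le> real (card ?A) * ?w (card X) (card K)"
    \<comment> \<open>Otherwise the natural-number difference \<open>card K - card X\<close>, and
      with it the left side, is 0.\<close>
    proof (cases "card X < card K")
      case True
      then have "?w (card X) (card K) = (real (card K - card X) * b (card X)) * ?w (Suc (card X)) (card K)"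
        unfolding addition_weight_def by (subst prod.atLeast_Suc_lessThan) auto
      moreover have "1 * (real (card K - card X) * ?w (Suc (card X)) (card K)) \<le>
          (real (card ?A) * b (card X)) * (real (card K - card X) * ?w (Suc (card X)) (card K))"
        using b False addition_weight_nonneg[of b]
        by (intro mult_right_mono mult_nonneg_nonneg) auto
      ultimately show ?thesis by (simp add: mult_ac)
    qed (use addition_weight_nonneg[of b] b(1) in auto)
    finally show "(\<Sum>v\<in>?A. if v \<in> K then ?w (Suc (card X)) (card K) else 0) \<le>
      real (card ?A) * ?w (card X) (card K)" .
  qed
  also have "\<dots> = real (card ?A) * potential b KK X"
    by (simp add: potential_def sum_distrib_left)
  finally show ?thesis .
qed simp

text \<open>Induction on \<open>T\<close>, conditioning on the first step: additions and rejections
  are controlled by superharmonicity of the potential, removals by an error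
  \<open>exp (- \<beta>)\<close> per step. The disjunction in \<open>C\<close> is the invariant. By
  \<open>entry\<close>, an addition from outside \<open>A\<close> leads outside \<open>A\<close>
  again or to a target in \<open>KK\<close>, where the potential is at least 1 and the bound is
  trivial.\<close>

lemma reach_prob_le_potential:
  assumes n: "n > 0" and \<beta>: "\<beta> \<ge> 0" and KK: "KK \<subseteq> cliques n E"
    and b: "\<And>l. 0 \<le> b l"
      "\<And>X. X \<in> cliques n E \<Longrightarrow> extensions n E X \<noteq> {} \<Longrightarrow>
         1 \<le> real (card (extensions n E X)) * b (card X)"
    and entry: "\<And>X v. X \<in> cliques n E \<Longrightarrow> X \<notin> A \<Longrightarrow> v \<in> extensions n E X \<Longrightarrow> insert v X \<in> A \<Longrightarrow>
         insert v X \<in> KK"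
    and C: "C \<in> cliques n E" "C \<notin> A \<or> C \<in> KK"
  shows "reach_prob (metropolis n E \<beta>) C T A \<le> potential b KK C + real T * exp (- \<beta>)"
  using C
proof (induction T arbitrary: C)
  have finKK: "finite KK"
    using KK finite_subset finite_cliques by blast
  have pot_nonneg: "0 \<le> potential b KK X" for X
    unfolding potential_def using b by (intro sum_nonneg addition_weight_nonneg) auto
  have target: "reach_prob (metropolis n E \<beta>) C T A \<le> potential b KK C + real T * exp (- \<beta>)"
    if "C \<in> KK" for C T
  proof -
    have "1 = addition_weight b (card C) (card C)"
      by (simp add: addition_weight_def)
    also have "\<dots> \<le> potential b KK C"
      unfolding potential_def using that b finKK
      by (intro member_le_sum[of C _ "\<lambda>K. addition_weight b (card C) (card K)"]
          addition_weight_nonneg) auto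
    finally show ?thesis
      using reach_prob_le_1[of "metropolis n E \<beta>" C T A] by (smt (verit) exp_ge_zero mult_nonneg_nonneg of_nat_0_le_iff)
  qed
  {
    case 0
    then show ?case using target[of C 0] pot_nonneg[of C] by (auto simp: reach_prob_0)
  next
    case (Suc T)
    let ?A = "extensions n E C" and ?h = "\<lambda>y. reach_prob (metropolis n E \<beta>) y T A"
    let ?e = "real T * exp (- \<beta>)" and ?a = "real (card (extensions n E C))"
    show ?case
    proof (cases "C \<in> KK")
      case False
      then have CA: "C \<notin> A" using Suc.prems by auto
      have le: "?a \<le> real n" using card_extensions_le[of n E C] by simp
      have "reach_prob (metropolis n E \<beta>) C (Suc T) A = measure_pmf.expectation (metropolis n E \<beta> C) ?h"
        by (rule reach_prob_Suc[OF CA])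
      also have "\<dots> \<le> exp (- \<beta>) + ((\<Sum>v\<in>?A. ?h (insert v C)) + (real n - ?a) * ?h C) / real n"
        using n Suc.prems \<beta> by (intro expectation_metropolis_le reach_prob_nonneg reach_prob_le_1)
      also have "\<dots> \<le> exp (- \<beta>) + ((\<Sum>v\<in>?A. potential b KK (insert v C) + ?e) +
          (real n - ?a) * (potential b KK C + ?e)) / real n"
      proof (intro add_left_mono divide_right_mono add_mono sum_mono mult_left_mono)
        fix v assume v: "v \<in> ?A"
        then show "?h (insert v C) \<le> potential b KK (insert v C) + ?e"
          using entry[of C v] CA Suc.prems by (intro Suc.IH) (auto simp: extensions_def)
      qed (use Suc le in auto)
      \<comment> \<open>The constant \<open>?e\<close> is averaged over all \<open>n\<close> picks,
        so it comes out unchanged.\<close>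
      also have "\<dots> = exp (- \<beta>) + ?e + ((\<Sum>v\<in>?A. potential b KK (insert v C)) +
          (real n - ?a) * potential b KK C) / real n"
        using n by (simp add: sum.distrib field_simps)
      also have "\<dots> \<le> exp (- \<beta>) + ?e + (?a * potential b KK C + (real n - ?a) * potential b KK C) / real n"
        using Suc.prems KK b by (intro add_left_mono divide_right_mono add_right_mono potential_superharmonic) auto
      also have "\<dots> = potential b KK C + real (Suc T) * exp (- \<beta>)"
        using n by (simp add: field_simps)
      finally show ?thesis .
    qed (rule target)
  }
qed

text \<open>The weight lacks the factors \<open>b l\<close> with \<open>l < card C\<close>. Each is
  at least \<open>1 / n\<close>, so inserting them costs at most \<open>n ^ card C\<close>; the
  factors \<open>card K - l\<close> cost at most \<open>m ^ m\<close>. Dropping the condition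
  \<open>C \<subseteq> K\<close> leaves a sum independent of \<open>C\<close>, so one first moment
  bound serves all starting cliques.\<close>

lemma potential_le:
  assumes n: "n > 0" and KK: "KK \<subseteq> cliques n E" and m: "\<And>K. K \<in> KK \<Longrightarrow> card K \<le> m" "m > 0"
    and b: "\<And>l. 1 / real n \<le> b l"
  shows "potential b KK C \<le> real m ^ m * real n ^ card C * (\<Sum>K\<in>KK. \<Prod>l<card K. b l)"
proof -
  have b0: "0 < b l" for l
    using b[of l] n by (smt (verit) divide_pos_pos of_nat_0_less_iff)
  then have b0': "0 \<le> b l" for l
    by (rule less_imp_le)
  have finKK: "finite KK"
    using KK finite_subset finite_cliques by blast
  have w: "addition_weight b (card C) (card K) \<le> real m ^ m * real n ^ card C * (\<Prod>l<card K. b l)"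
    if "K \<in> KK" "C \<subseteq> K" for K
  proof -
    have finK: "finite K"
      using KK that finite_clique by blast
    have CK: "card C \<le> card K" using that finK by (simp add: card_mono)
    have "addition_weight b (card C) (card K) =
        (\<Prod>l\<in>{card C..<card K}. real (card K - l)) * (\<Prod>l\<in>{card C..<card K}. b l)"
      by (simp add: addition_weight_def prod.distrib)
    also have "\<dots> \<le> real m ^ m * (real n ^ card C * (\<Prod>l<card K. b l))"
    proof (intro mult_mono)
      have "(\<Prod>l\<in>{card C..<card K}. real (card K - l)) \<le> (\<Prod>l\<in>{card C..<card K}. real m)"
        using m(1)[OF that(1)] by (intro prod_mono) auto
      also have "\<dots> \<le> real m ^ m"
        using m(1)[OF that(1)] m(2) by (auto intro!: power_increasing)
      finally show "(\<Prod>l\<in>{card C..<card K}. real (card K - l)) \<le> real m ^ m" .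
      have "1 \<le> (\<Prod>l<card C. real n * b l)"
        using b n by (intro prod_ge_1) (auto simp: field_simps)
      then have "1 * (\<Prod>l\<in>{card C..<card K}. b l) \<le> (\<Prod>l<card C. real n * b l) * (\<Prod>l\<in>{card C..<card K}. b l)"
        using b0' by (intro mult_right_mono prod_nonneg) auto
      also have "\<dots> = real n ^ card C * ((\<Prod>l\<in>{0..<card C}. b l) * (\<Prod>l\<in>{card C..<card K}. b l))"
        by (simp add: prod.distrib lessThan_atLeast0)
      also have "(\<Prod>l\<in>{0..<card C}. b l) * (\<Prod>l\<in>{card C..<card K}. b l) = (\<Prod>l<card K. b l)"
        using CK by (simp add: prod.atLeastLessThan_concat lessThan_atLeast0)
      finally show "(\<Prod>l\<in>{card C..<card K}. b l) \<le> real n ^ card C * (\<Prod>l<card K. b l)" by simp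
    qed (use b0' in \<open>auto intro!: prod_nonneg\<close>)
    finally show ?thesis by simp
  qed
  have "potential b KK C \<le> (\<Sum>K\<in>{K\<in>KK. C \<subseteq> K}. real m ^ m * real n ^ card C * (\<Prod>l<card K. b l))"
    unfolding potential_def by (intro sum_mono w) auto
  also have "\<dots> \<le> (\<Sum>K\<in>KK. real m ^ m * real n ^ card C * (\<Prod>l<card K. b l))"
    using finKK b0' by (intro sum_mono2 mult_nonneg_nonneg prod_nonneg) auto
  finally show ?thesis by (simp add: sum_distrib_left)
qed

section \<open>Common neighbours and cliques in the random graph\<close>

text \<open>\<open>P\<close> reads only coordinates in \<open>A\<close> and \<open>Q\<close> only
  coordinates outside \<open>A\<close>, and \<open>Pi_pmf\<close> splits into independent factors
  over \<open>A\<close> and \<open>I - A\<close>.\<close>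

lemma prob_Pi_pmf_indep:
  assumes "finite I" "A \<subseteq> I" "B \<subseteq> I" "A \<inter> B = {}"
    and P: "\<And>f g. (\<And>x. x \<in> A \<Longrightarrow> f x = g x) \<Longrightarrow> P f = P g"
    and Q: "\<And>f g. (\<And>x. x \<in> B \<Longrightarrow> f x = g x) \<Longrightarrow> Q f = Q g"
  shows "measure_pmf.prob (Pi_pmf I d p) {f. P f \<and> Q f} =
    measure_pmf.prob (Pi_pmf I d p) {f. P f} * measure_pmf.prob (Pi_pmf I d p) {f. Q f}"
proof -
  let ?pA = "Pi_pmf A d p" and ?pR = "Pi_pmf (I - A) d p"
  let ?h = "\<lambda>(f, g) x. if x \<in> A then f x else g x"
  have fin: "finite A" using assms finite_subset by blast
  have union: "Pi_pmf I d p = map_pmf ?h (pair_pmf ?pA ?pR)"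
    using Pi_pmf_union[of A "I - A" d p] assms fin by (simp add: Un_absorb1)
  have P': "P (\<lambda>x. if x \<in> A then f x else g x) = P f" for f g
    by (rule P) auto
  have Q': "Q (\<lambda>x. if x \<in> A then f x else g x) = Q g" for f g
    using assms by (intro Q) auto
  have eqs: "?h -` {f. P f \<and> Q f} = {f. P f} \<times> {f. Q f}"
    "?h -` {f. P f} = {f. P f} \<times> UNIV" "?h -` {f. Q f} = UNIV \<times> {f. Q f}"
    by (auto simp: P' Q')
  have prod: "measure_pmf.prob (pair_pmf ?pA ?pR) (S \<times> T) =
      measure_pmf.prob ?pA S * measure_pmf.prob ?pR T" for S T
  proof -
    \<comment> \<open>Intersecting with the supports makes both sets countable, as the product rule
      requires.\<close>
    have "measure_pmf.prob (pair_pmf ?pA ?pR) (S \<times> T) =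
        measure_pmf.prob (pair_pmf ?pA ?pR) ((S \<inter> set_pmf ?pA) \<times> (T \<inter> set_pmf ?pR))"
      by (rule measure_prob_cong_0) (auto simp: pmf_pair set_pmf_iff)
    also have "\<dots> = measure_pmf.prob ?pA S * measure_pmf.prob ?pR T"
      by (subst measure_pmf_prob_product) (auto simp: measure_Int_set_pmf intro: countable_Int2)
    finally show ?thesis .
  qed
  show ?thesis
    unfolding union measure_map_pmf eqs prod by simp
qed

lemma finite_edges [simp]: "finite (nsets {..<n::nat} 2)"
  by (simp add: finite_imp_finite_nsets)

lemma prob_gnp_half:
  "measure_pmf.prob (gnp_half n) {E. P E} =
   measure_pmf.prob (Pi_pmf (nsets {..<n} 2) False (\<lambda>_. bernoulli_pmf (1 / 2)))
     {f. P {e \<in> nsets {..<n} 2. f e}}"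
  by (simp add: gnp_half_def vimage_def)

lemma prob_gnp_half_superset:
  assumes "F \<subseteq> nsets {..<n} 2"
  shows "measure_pmf.prob (gnp_half n) {E. F \<subseteq> E} = (1 / 2) ^ card F"
proof -
  let ?I = "nsets {..<n} 2"
  have "measure_pmf.prob (gnp_half n) {E. F \<subseteq> E} =
      measure_pmf.prob (Pi_pmf ?I False (\<lambda>_. bernoulli_pmf (1 / 2)))
        (Pi ?I (\<lambda>e. if e \<in> F then {True} else UNIV))"
    unfolding prob_gnp_half
    using assms by (intro arg_cong2[where f = measure_pmf.prob] refl)
      (auto simp: Pi_def subset_iff split: if_splits)
  also have "\<dots> = (\<Prod>e\<in>?I. if e \<in> F then 1 / 2 else 1)"
    by (subst measure_Pi_pmf_Pi) (auto intro!: prod.cong simp: measure_pmf_single)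
  also have "\<dots> = (1 / 2) ^ card F"
    using assms by (simp add: prod.If_cases Int_absorb1)
  finally show ?thesis .
qed

text \<open>For distinct \<open>w\<close> the sets of pairs joining \<open>w\<close> to
  \<open>X\<close> are disjoint, because \<open>W\<close> avoids \<open>X\<close>. The events are
  therefore independent, each of probability \<open>1 - (1 / 2) ^ card X\<close>.\<close>

lemma prob_gnp_half_no_common_neighbour:
  assumes "X \<subseteq> {..<n}" "W \<subseteq> {..<n}" "X \<inter> W = {}"
  shows "measure_pmf.prob (gnp_half n) {E. \<forall>w\<in>W. \<exists>x\<in>X. {x, w} \<notin> E} = (1 - (1 / 2) ^ card X) ^ card W"
proof -
  let ?I = "nsets {..<n} 2"
  let ?p = "Pi_pmf ?I False (\<lambda>_. bernoulli_pmf (1 / 2))"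
  let ?star = "\<lambda>w. (\<lambda>x. {x, w}) ` X"
  have one: "measure_pmf.prob ?p {f. \<exists>x\<in>X. \<not> f {x, w}} = 1 - (1 / 2) ^ card X" if "w < n" "w \<notin> X" for w
  proof -
    have sub: "?star w \<subseteq> ?I" using that assms by auto
    have "inj_on (\<lambda>x. {x, w}) X"
      by (auto simp: inj_on_def doubleton_eq_iff)
    then have c: "card (?star w) = card X" by (rule card_image)
    have "measure_pmf.prob ?p {f. \<forall>x\<in>X. f {x, w}} = measure_pmf.prob (gnp_half n) {E. ?star w \<subseteq> E}"
      unfolding prob_gnp_half
      using sub by (intro arg_cong2[where f = measure_pmf.prob] refl) auto
    also have "\<dots> = (1 / 2) ^ card X"
      using prob_gnp_half_superset[OF sub] c by simp
    finally have "measure_pmf.prob ?p {f. \<forall>x\<in>X. f {x, w}} = (1 / 2) ^ card X" .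
    moreover have "{f. \<exists>x\<in>X. \<not> f {x, w}} = UNIV - {f. \<forall>x\<in>X. f {x, w}}" by auto
    ultimately show ?thesis
      using measure_pmf.prob_compl[of "{f. \<forall>x\<in>X. f {x, w}}" ?p] by simp
  qed
  have "finite W" using assms finite_subset by blast
  then have "measure_pmf.prob ?p {f. \<forall>w\<in>W. \<exists>x\<in>X. \<not> f {x, w}} = (1 - (1 / 2) ^ card X) ^ card W"
    using assms(2,3)
  proof (induction W rule: finite_induct)
    case (insert w W)
    have "measure_pmf.prob ?p {f. \<forall>w\<in>insert w W. \<exists>x\<in>X. \<not> f {x, w}} =
        measure_pmf.prob ?p {f. (\<exists>x\<in>X. \<not> f {x, w}) \<and> (\<forall>w\<in>W. \<exists>x\<in>X. \<not> f {x, w})}"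
      by simp
    also have "\<dots> = measure_pmf.prob ?p {f. \<exists>x\<in>X. \<not> f {x, w}} *
        measure_pmf.prob ?p {f. \<forall>w\<in>W. \<exists>x\<in>X. \<not> f {x, w}}"
    proof (rule prob_Pi_pmf_indep[where A = "?star w" and B = "\<Union>w\<in>W. ?star w"])
      show "?star w \<subseteq> ?I" "(\<Union>w\<in>W. ?star w) \<subseteq> ?I"
        using insert.prems assms(1) by auto
      show "?star w \<inter> (\<Union>w\<in>W. ?star w) = {}"
        using insert.prems insert.hyps by (auto simp: doubleton_eq_iff)
      fix f g :: "nat set \<Rightarrow> bool"
      assume "f e = g e" if "e \<in> (\<Union>w\<in>W. ?star w)" for e
      then have "f {x, w} = g {x, w}" if "w \<in> W" "x \<in> X" for x w
        using that by blast
      then show "(\<forall>w\<in>W. \<exists>x\<in>X. \<not> f {x, w}) = (\<forall>w\<in>W. \<exists>x\<in>X. \<not> g {x, w})"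
        by simp
    qed auto
    also have "\<dots> = (1 - (1 / 2) ^ card X) ^ card (insert w W)"
      using insert by (subst one) auto
    finally show ?case .
  qed simp
  moreover have "measure_pmf.prob (gnp_half n) {E. \<forall>w\<in>W. \<exists>x\<in>X. {x, w} \<notin> E} =
      measure_pmf.prob ?p {f. \<forall>w\<in>W. \<exists>x\<in>X. \<not> f {x, w}}"
    unfolding prob_gnp_half
  proof (intro arg_cong2[where f = measure_pmf.prob] refl Collect_cong)
    have "{x, w} \<in> ?I" if "x \<in> X" "w \<in> W" for x w
      using that assms by auto
    then show "(\<forall>w\<in>W. \<exists>x\<in>X. {x, w} \<notin> {e \<in> ?I. f e}) = (\<forall>w\<in>W. \<exists>x\<in>X. \<not> f {x, w})" for f
      by blast
  qed
  ultimately show ?thesis by simp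
qed

definition common_neighbours :: "nat \<Rightarrow> nat set set \<Rightarrow> nat set \<Rightarrow> nat set" where
  "common_neighbours n E X = {v \<in> {..<n} - X. \<forall>x\<in>X. {x, v} \<in> E}"

text \<open>If \<open>X\<close> has at most \<open>a (card X)\<close> common neighbours, they lie in
  some \<open>S\<close> of exactly that size, and no vertex outside \<open>X\<close> and
  \<open>S\<close> is a common neighbour. A union bound over the pairs \<open>(X, S)\<close>, at
  most \<open>n ^ (i + a i)\<close> of them for \<open>card X = i\<close>, takes the place of a
  binomial tail estimate.\<close>

lemma prob_few_common_neighbours:
  assumes a: "\<And>i. i < s \<Longrightarrow> a i \<le> n"
  shows "measure_pmf.prob (gnp_half n)
     {E. \<exists>X\<subseteq>{..<n}. card X < s \<and> card (common_neighbours n E X) \<le> a (card X)} \<le>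
   (\<Sum>i<s. real n ^ (i + a i) * (1 - (1 / 2) ^ i) ^ (n - i - a i))"
proof -
  let ?sub = "\<lambda>i. {X. X \<subseteq> {..<n} \<and> card X = i}"
  let ?bad = "\<lambda>X S. {E. \<forall>w\<in>{..<n} - X - S. \<exists>x\<in>X. {x, w} \<notin> E}"
  let ?M = "gnp_half n"
  have finsub: "finite (?sub i)" for i by simp
  have cover: "{E. \<exists>X\<subseteq>{..<n}. card X < s \<and> card (common_neighbours n E X) \<le> a (card X)} \<subseteq>
      (\<Union>i<s. \<Union>(X, S)\<in>?sub i \<times> ?sub (a i). ?bad X S)"
  proof safe
    fix E X assume X: "X \<subseteq> {..<n}" "card X < s" "card (common_neighbours n E X) \<le> a (card X)"
    obtain S where S: "common_neighbours n E X \<subseteq> S" "S \<subseteq> {..<n}" "card S = a (card X)"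
      using exists_subset_between[of "common_neighbours n E X" "a (card X)" "{..<n}"] X a
      by (auto simp: common_neighbours_def)
    have "E \<in> ?bad X S"
      using S(1) by (auto simp: common_neighbours_def)
    then show "E \<in> (\<Union>i<s. \<Union>(X, S)\<in>?sub i \<times> ?sub (a i). ?bad X S)"
      using X S by (intro UN_I[of "card X"] UN_I[of "(X, S)"]) auto
  qed
  have bad: "measure_pmf.prob ?M (?bad X S) \<le> (1 - (1 / 2) ^ i) ^ (n - i - a i)"
    if "X \<in> ?sub i" "S \<in> ?sub (a i)" for X S i
  proof -
    have fin: "finite X" "finite S"
      using that finite_subset by blast+
    have "card {..<n} - card X \<le> card ({..<n} - X)"
      using fin by (intro diff_card_le_card_Diff) auto
    moreover have "card ({..<n} - X) - card S \<le> card ({..<n} - X - S)"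
      using fin by (intro diff_card_le_card_Diff) auto
    ultimately have "n - i - a i \<le> card ({..<n} - X - S)"
      using that by simp
    then have "(1 - (1 / 2) ^ i :: real) ^ card ({..<n} - X - S) \<le> (1 - (1 / 2) ^ i) ^ (n - i - a i)"
      by (intro power_decreasing) (auto simp: power_le_one)
    moreover have "measure_pmf.prob ?M (?bad X S) = (1 - (1 / 2) ^ i) ^ card ({..<n} - X - S)"
      using that by (subst prob_gnp_half_no_common_neighbour) auto
    ultimately show ?thesis by simp
  qed
  have "measure_pmf.prob ?M {E. \<exists>X\<subseteq>{..<n}. card X < s \<and> card (common_neighbours n E X) \<le> a (card X)} \<le>
      measure_pmf.prob ?M (\<Union>i<s. \<Union>(X, S)\<in>?sub i \<times> ?sub (a i). ?bad X S)"
    using cover by (intro measure_pmf.finite_measure_mono) auto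
  also have "\<dots> \<le> (\<Sum>i<s. measure_pmf.prob ?M (\<Union>(X, S)\<in>?sub i \<times> ?sub (a i). ?bad X S))"
    by (intro measure_pmf.finite_measure_subadditive_finite) auto
  also have "\<dots> \<le> (\<Sum>i<s. real n ^ (i + a i) * (1 - (1 / 2) ^ i) ^ (n - i - a i))"
  proof (intro sum_mono)
    fix i assume i: "i \<in> {..<s}"
    have "measure_pmf.prob ?M (\<Union>(X, S)\<in>?sub i \<times> ?sub (a i). ?bad X S) \<le>
        (\<Sum>q\<in>?sub i \<times> ?sub (a i). measure_pmf.prob ?M (case q of (X, S) \<Rightarrow> ?bad X S))"
      by (intro measure_pmf.finite_measure_subadditive_finite) auto
    also have "\<dots> \<le> (\<Sum>q\<in>?sub i \<times> ?sub (a i). (1 - (1 / 2) ^ i) ^ (n - i - a i))"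
      by (intro sum_mono) (use bad[of _ i] in auto)
    also have "\<dots> = real ((n choose i) * (n choose a i)) * (1 - (1 / 2) ^ i) ^ (n - i - a i)"
      by (simp add: card_cartesian_product n_subsets)
    also have "\<dots> \<le> real n ^ (i + a i) * (1 - (1 / 2) ^ i) ^ (n - i - a i)"
    proof (intro mult_right_mono zero_le_power)
      have "n choose i \<le> n ^ i" "n choose a i \<le> n ^ a i"
        using binomial_le_pow[of i n] binomial_le_pow[of "a i" n] a[of i] i
        by (cases "i \<le> n"; force simp: binomial_eq_0)+
      then show "real ((n choose i) * (n choose a i)) \<le> real n ^ (i + a i)"
        unfolding power_add of_nat_mult
        by (intro mult_mono) (simp_all flip: of_nat_power)
    qed (auto simp: power_le_one)
    finally show "measure_pmf.prob ?M (\<Union>(X, S)\<in>?sub i \<times> ?sub (a i). ?bad X S) \<le>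
      real n ^ (i + a i) * (1 - (1 / 2) ^ i) ^ (n - i - a i)" .
  qed
  finally show ?thesis .
qed

section \<open>Cliques of the planted graph for a fixed planted set\<close>

lemma card_nsets: "finite A \<Longrightarrow> card (nsets A k) = card A choose k"
  by (simp add: nsets_def n_subsets[symmetric]) (meson finite_subset)

text \<open>Pairs inside \<open>PC\<close> are present anyway, so only the pairs of \<open>K\<close>
  not contained in \<open>PC\<close> must be edges of \<open>E\<close>.\<close>

lemma prob_planted_clique_contains:
  assumes "K \<subseteq> {..<n}"
  shows "measure_pmf.prob (gnp_half n) {E. K \<in> cliques n (E \<union> nsets PC 2)} =
    (1 / 2) ^ ((card K choose 2) - (card (K \<inter> PC) choose 2))"
proof -
  have finK: "finite K" using assms finite_subset by blast
  have "{E. K \<in> cliques n (E \<union> nsets PC 2)} = {E. nsets K 2 - nsets (K \<inter> PC) 2 \<subseteq> E}"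
  proof -
    have "K \<in> cliques n (E \<union> nsets PC 2) \<longleftrightarrow>
        (\<forall>v\<in>K. \<forall>w\<in>K. v \<noteq> w \<longrightarrow> {v, w} \<in> E \<or> v \<in> PC \<and> w \<in> PC)" for E
      using assms by (auto simp: cliques_def clique_def)
    moreover have "nsets K 2 - nsets (K \<inter> PC) 2 \<subseteq> E \<longleftrightarrow>
        (\<forall>v\<in>K. \<forall>w\<in>K. v \<noteq> w \<longrightarrow> {v, w} \<in> E \<or> v \<in> PC \<and> w \<in> PC)" for E
    proof
      show "\<forall>v\<in>K. \<forall>w\<in>K. v \<noteq> w \<longrightarrow> {v, w} \<in> E \<or> v \<in> PC \<and> w \<in> PC"
        if "nsets K 2 - nsets (K \<inter> PC) 2 \<subseteq> E"
      proof (intro ballI impI)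
        fix v w assume "v \<in> K" "w \<in> K" "v \<noteq> w"
        then show "{v, w} \<in> E \<or> v \<in> PC \<and> w \<in> PC"
          using subsetD[OF that, of "{v, w}"] by auto
      qed
    qed (auto elim!: nsets2_E; blast)
    ultimately show ?thesis by auto
  qed
  moreover have "nsets K 2 - nsets (K \<inter> PC) 2 \<subseteq> nsets {..<n} 2"
    using nsets_mono[OF assms] by blast
  moreover have "card (nsets K 2 - nsets (K \<inter> PC) 2) = (card K choose 2) - (card (K \<inter> PC) choose 2)"
    using finK by (subst card_Diff_subset) (auto simp: card_nsets nsets_mono finite_imp_finite_nsets)
  ultimately show ?thesis
    by (simp add: prob_gnp_half_superset)
qed

text \<open>A set \<open>K\<close> is determined by \<open>K \<inter> PC\<close> and
  \<open>K - PC\<close>. Counting them separately keeps the gain from the small size of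
  \<open>PC\<close> for each vertex in the intersection.\<close>

lemma card_subsets_meeting_le:
  assumes "finite V" "PC \<subseteq> V" "j \<le> i"
  shows "card {K. K \<subseteq> V \<and> card K = i \<and> card (K \<inter> PC) = j} \<le> card PC ^ j * card V ^ (i - j)"
proof -
  have finPC: "finite PC" using assms finite_subset by blast
  let ?S = "{A. A \<subseteq> PC \<and> card A = j}" and ?T = "{B. B \<subseteq> V \<and> card B = i - j}"
  have "card {K. K \<subseteq> V \<and> card K = i \<and> card (K \<inter> PC) = j} \<le> card (?S \<times> ?T)"
  proof (rule card_inj_on_le)
    show "inj_on (\<lambda>K. (K \<inter> PC, K - PC)) {K. K \<subseteq> V \<and> card K = i \<and> card (K \<inter> PC) = j}"
      by (auto simp: inj_on_def)
    have "card (K - PC) = card K - card (K \<inter> PC)" if "K \<subseteq> V" for K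
      using that assms finPC by (intro card_Diff_subset_Int) auto
    then show "(\<lambda>K. (K \<inter> PC, K - PC)) ` {K. K \<subseteq> V \<and> card K = i \<and> card (K \<inter> PC) = j} \<subseteq> ?S \<times> ?T"
      by auto
    show "finite (?S \<times> ?T)" using assms finPC by auto
  qed
  also have "card (?S \<times> ?T) = (card PC choose j) * (card V choose (i - j))"
    using assms finPC by (simp add: card_cartesian_product n_subsets)
  also have "\<dots> \<le> card PC ^ j * card V ^ (i - j)"
  proof (intro mult_mono)
    show "card PC choose j \<le> card PC ^ j"
      using binomial_le_pow[of j "card PC"] by (cases "j \<le> card PC") (auto simp: binomial_eq_0)
    show "card V choose (i - j) \<le> card V ^ (i - j)"
      using binomial_le_pow[of "i - j" "card V"] by (cases "i - j \<le> card V") (auto simp: binomial_eq_0)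
  qed auto
  finally show ?thesis .
qed

lemma expectation_weighted_clique_count:
  fixes g :: "nat set \<Rightarrow> real"
  assumes T: "T \<subseteq> Pow {..<n}"
  shows "measure_pmf.expectation (gnp_half n) (\<lambda>E. \<Sum>K\<in>T \<inter> cliques n (E \<union> nsets PC 2). g K) =
    (\<Sum>K\<in>T. g K * (1 / 2) ^ ((card K choose 2) - (card (K \<inter> PC) choose 2)))"
proof -
  have finT: "finite T" using T finite_subset by blast
  have eq: "(\<Sum>K\<in>T \<inter> cliques n (E \<union> nsets PC 2). g K) =
      (\<Sum>K\<in>T. g K * indicator {E. K \<in> cliques n (E \<union> nsets PC 2)} E)" for E
    using finT by (simp add: sum.inter_restrict indicator_def of_bool_def if_distrib cong: if_cong)
  have "measure_pmf.expectation (gnp_half n) (\<lambda>E. \<Sum>K\<in>T \<inter> cliques n (E \<union> nsets PC 2). g K) =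
      (\<Sum>K\<in>T. g K * measure_pmf.prob (gnp_half n) {E. K \<in> cliques n (E \<union> nsets PC 2)})"
    unfolding eq by (subst Bochner_Integration.integral_sum)
      (auto intro!: integrable_mult_right integrable_real_indicator simp: measure_pmf.emeasure_eq_measure)
  also have "\<dots> = (\<Sum>K\<in>T. g K * (1 / 2) ^ ((card K choose 2) - (card (K \<inter> PC) choose 2)))"
    using T by (intro sum.cong refl, subst prob_planted_clique_contains) auto
  finally show ?thesis .
qed

lemma integrable_gnp_half: "integrable (measure_pmf (gnp_half n)) (f :: _ \<Rightarrow> real)"
proof -
  have "finite (set_pmf (gnp_half n))"
    by (rule finite_subset[of _ "Pow (nsets {..<n} 2)"]) (auto simp: gnp_half_def)
  then show ?thesis by (rule integrable_measure_pmf_finite)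
qed

text \<open>The base graph and the planted set are independent and may be sampled in the other
  order, so it suffices to bound the failure probability for each fixed \<open>PC\<close>.\<close>

lemma prob_planted_clique_ge:
  assumes "k \<le> n"
    and "\<And>PC. PC \<subseteq> {..<n} \<Longrightarrow> card PC = k \<Longrightarrow>
      measure_pmf.prob (gnp_half n) {E. \<not> P (E \<union> nsets PC 2, PC)} \<le> \<eta>"
  shows "1 - \<eta> \<le> measure_pmf.prob (planted_clique n k) {x. P x}"
proof -
  let ?S = "{S. S \<subseteq> {..<n} \<and> card S = k}"
  have "card ?S = (n choose k)" by (simp add: n_subsets)
  then have "card ?S \<noteq> 0" using assms(1) by (simp add: binomial_eq_0_iff)
  then have ne: "?S \<noteq> {}" by (metis card.empty)
  have fin: "finite ?S" by simp
  have ge: "1 - \<eta> \<le> measure_pmf.prob (gnp_half n) {E. P (E \<union> nsets PC 2, PC)}" if "PC \<in> ?S" for PC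
  proof -
    have "{E. \<not> P (E \<union> nsets PC 2, PC)} = UNIV - {E. P (E \<union> nsets PC 2, PC)}" by auto
    then show ?thesis
      using assms(2)[of PC] that measure_pmf.prob_compl[of "{E. P (E \<union> nsets PC 2, PC)}" "gnp_half n"]
      by simp
  qed
  have pc: "planted_clique n k = pmf_of_set ?S \<bind>
      (\<lambda>PC. map_pmf (\<lambda>E. (E \<union> nsets PC 2, PC)) (gnp_half n))"
    unfolding planted_clique_def map_pmf_def by (rule bind_commute_pmf)
  have "1 - \<eta> = measure_pmf.expectation (pmf_of_set ?S) (\<lambda>_. 1 - \<eta>)" by simp
  also have "\<dots> \<le> measure_pmf.expectation (pmf_of_set ?S)
      (\<lambda>PC. measure_pmf.prob (gnp_half n) {E. P (E \<union> nsets PC 2, PC)})"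
    using ge ne fin by (intro integral_mono_AE integrable_measure_pmf_finite)
      (auto simp: AE_measure_pmf_iff set_pmf_of_set)
  also have "\<dots> = measure_pmf.prob (planted_clique n k) {x. P x}"
    unfolding pc by (simp add: vimage_def prob_bind_pmf)
  finally show ?thesis .
qed

section \<open>The first moment of the weighted clique count\<close>

lemma real_choose_2: "real (i choose 2) = real i * (real i - 1) / 2"
proof (induction i)
  case (Suc i)
  have "real (Suc i choose 2) = real (i choose 2) + real i"
    by (simp add: numeral_2_eq_2)
  then show ?case unfolding Suc by (simp add: field_simps)
qed simp

lemma prod_two_powr: "(\<Prod>l<u. 2 ^ l * (2::real) powr c) = 2 powr (real (u choose 2) + real u * c)"
proof (induction u)
  case (Suc u)
  have c: "real (Suc u choose 2) = real (u choose 2) + real u"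
    by (simp add: numeral_2_eq_2)
  have "(\<Prod>l<Suc u. 2 ^ l * 2 powr c) = 2 powr (real (u choose 2) + real u * c) * 2 powr (real u + c)"
    unfolding prod.lessThan_Suc Suc by (simp add: powr_add powr_realpow)
  also have "\<dots> = 2 powr (real (Suc u choose 2) + real (Suc u) * c)"
    unfolding c powr_add[symmetric]
    by (rule arg_cong[where f = "(powr) 2"]) (simp add: algebra_simps)
  finally show ?case .
qed simp

lemma half_power: "(1 / 2 :: real) ^ d = 2 powr (- real d)"
  by (simp only: powr_minus powr_realpow zero_less_numeral divide_inverse mult_1 power_inverse)

text \<open>The choice of \<open>b\<close> in the addition weight. Below size \<open>s\<close> it is
  the inverse of the lower bound \<open>n powr (1 - \<theta>) / 2 ^ l\<close> on the number of
  common neighbours; from \<open>s\<close> on, only the existence of an extension is used, whence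
  the value 1.\<close>

definition step_weight :: "nat \<Rightarrow> real \<Rightarrow> nat \<Rightarrow> nat \<Rightarrow> real" where
  "step_weight n \<theta> s l = (if l < s then 2 ^ l * real n powr (\<theta> - 1) else 1)"

lemma step_weight_ge:
  assumes "n > 0" "\<theta> \<ge> 0"
  shows "1 / real n \<le> step_weight n \<theta> s l"
proof -
  have n1: "1 \<le> real n" using assms by simp
  have "1 / real n = 1 * real n powr (-1)"
    using n1 by (simp add: powr_minus divide_inverse)
  also have "\<dots> \<le> 2 ^ l * real n powr (\<theta> - 1)"
    using n1 assms by (intro mult_mono powr_mono) auto
  finally show ?thesis
    using n1 by (auto simp: step_weight_def field_simps)
qed

text \<open>The left side is the base-2 logarithm of a bound on the contribution of all targets with
  \<open>card K = i\<close> and \<open>card (K \<inter> PC) = j\<close>. Its groups of terms come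
  from the number of such sets, the probability that one of them is a clique, and the product of the
  step weights over sizes below \<open>u\<close>.\<close>

lemma exponent_bound:
  fixes L \<alpha> \<epsilon> \<gamma> \<theta> i j s u :: real
  assumes L: "1 \<le> L" "2 \<le> \<epsilon> * L"
    and \<alpha>: "0 \<le> \<alpha>" "\<alpha> < 1" and \<gamma>: "0 < \<gamma>" "\<gamma> \<le> 1 - \<alpha>"
    and \<theta>: "0 \<le> \<theta>" "\<theta> \<le> 1" "8 * \<theta> \<le> \<epsilon>\<^sup>2 / 4" "8 * \<theta> \<le> \<gamma> * (1 - \<alpha>) / 2"
    and s: "0 \<le> s" "(1 - \<theta>) * L - 1 \<le> s" "s \<le> (1 - \<theta>) * L"
    and i: "0 \<le> i" and j: "0 \<le> j" "j \<le> \<gamma> * L + 1" and u: "u = min s i"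
    and hit: "(1 + \<epsilon>) * L \<le> i \<or> \<gamma> * L \<le> j"
  shows "\<alpha> * L * j + L * (i - j) - (i * (i - 1) / 2 - j * (j - 1) / 2) + (u * (u - 1) / 2 + u * (L * (\<theta> - 1)))
    \<le> 4 - 6 * \<theta> * L\<^sup>2"
proof -
  define G where "G = L * i - i * (i - 1) / 2 - (L * u - u * (u - 1) / 2)"
  define H where "H = j * ((1 - \<alpha>) * L - (j - 1) / 2)"
  \<comment> \<open>completing the square in \<open>G\<close> exhibits losses of order \<open>\<epsilon>\<^sup>2 L\<^sup>2\<close> (for \<open>i \<ge> (1 + \<epsilon>) L\<close>)
    and, from \<open>H\<close>, \<open>\<gamma> (1 - \<alpha>) L\<^sup>2\<close> (for \<open>j \<ge> \<gamma> L\<close>)\<close>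
  have split: "\<alpha> * L * j + L * (i - j) - (i * (i - 1) / 2 - j * (j - 1) / 2) + (u * (u - 1) / 2 + u * (L * (\<theta> - 1)))
      = G - H + \<theta> * L * u"
    by (simp add: G_def H_def field_simps)
  have "u \<le> (1 - \<theta>) * L" using s u by simp
  also have "\<dots> \<le> 1 * L" using \<theta> L by (intro mult_right_mono) auto
  finally have "\<theta> * L * u \<le> \<theta> * L * L"
    using \<theta> L by (intro mult_left_mono) auto
  then have U: "\<theta> * L * u \<le> \<theta> * L\<^sup>2" by (simp add: power2_eq_square mult_ac)
  have \<theta>L: "0 \<le> \<theta> * L" using \<theta> L by simp
  \<comment> \<open>\<open>s\<close> is at most \<open>\<theta> * L + 1\<close> below
    \<open>L\<close>. The square is split by \<open>(x + 2)^2 \<le> 2 * x^2 + 8\<close>, and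
    \<open>\<theta>^2 \<le> \<theta>\<close> makes the result linear in
    \<open>\<theta>\<close>.\<close>
  have sq: "(L + 1/2 - s)\<^sup>2 / 2 \<le> \<theta> * L\<^sup>2 + 4"
  proof -
    have "0 \<le> L + 1/2 - s" "L + 1/2 - s \<le> \<theta> * L + 2"
      using s L \<theta>L by (auto simp: algebra_simps)
    then have "(L + 1/2 - s)\<^sup>2 \<le> (\<theta> * L + 2)\<^sup>2" by (intro power_mono) auto
    also have "\<dots> \<le> 2 * (\<theta> * L)\<^sup>2 + 8"
      using zero_le_power2[of "\<theta> * L - 2"] by (simp add: power2_eq_square algebra_simps)
    also have "(\<theta> * L)\<^sup>2 \<le> \<theta> * L\<^sup>2"
      using mult_right_mono[of "\<theta>\<^sup>2" \<theta> "L\<^sup>2"] \<theta> mult_left_mono[of \<theta> 1 \<theta>]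
      by (simp add: power_mult_distrib power2_eq_square mult_ac)
    finally show ?thesis by simp
  qed
  have G_eq: "G = (L + 1/2 - s)\<^sup>2 / 2 - (i - L - 1/2)\<^sup>2 / 2" if "u = s"
    unfolding G_def that by (simp add: power2_eq_square field_simps)
  have G_le: "G \<le> \<theta> * L\<^sup>2 + 4"
  proof (cases "i \<le> s")
    case True
    then have "G = 0" using u by (simp add: G_def)
    then show ?thesis using \<theta> by simp
  next
    case False
    then show ?thesis using G_eq u sq zero_le_power2[of "i - L - 1/2"] by linarith
  qed
  \<comment> \<open>Since \<open>j - 1 \<le> \<gamma> * L \<le> (1 - \<alpha>) * L\<close>, the term
    \<open>(j - 1) / 2\<close> takes away at most half of \<open>(1 - \<alpha>) * L\<close>.\<close>
  have H: "j * ((1 - \<alpha>) * L / 2) \<le> H"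
  proof -
    have "\<gamma> * L \<le> (1 - \<alpha>) * L" using \<gamma> L by (intro mult_right_mono) auto
    then have "j - 1 \<le> (1 - \<alpha>) * L" using j by linarith
    then have "(1 - \<alpha>) * L / 2 \<le> (1 - \<alpha>) * L - (j - 1) / 2" by (simp add: field_simps)
    then show ?thesis unfolding H_def using j by (intro mult_left_mono) auto
  qed
  have H0: "0 \<le> j * ((1 - \<alpha>) * L / 2)" using j \<alpha> L by simp
  have "G - H \<le> 4 + \<theta> * L\<^sup>2 - 8 * \<theta> * L\<^sup>2"
    using hit
  proof
    assume ge: "(1 + \<epsilon>) * L \<le> i"
    then have "s \<le> i"
      using s L \<theta>L by (simp add: algebra_simps)
    then have us: "u = s" using u by simp
    \<comment> \<open>\<open>2 \<le> \<epsilon> * L\<close> bounds the shift \<open>1/2\<close> by a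
      quarter of \<open>\<epsilon> * L\<close>. Half of \<open>9/16\<close> exceeds the
      \<open>1/4\<close> in the assumption on \<open>\<theta>\<close>.\<close>
    have "(\<epsilon> * L * (3/4))\<^sup>2 \<le> (i - L - 1/2)\<^sup>2"
      using ge L by (intro power_mono) (auto simp: algebra_simps)
    moreover have "(\<epsilon> * L * (3/4))\<^sup>2 = \<epsilon>\<^sup>2 * L\<^sup>2 * (9/16)"
      by (simp add: power_mult_distrib power2_eq_square)
    moreover have "8 * \<theta> * L\<^sup>2 \<le> \<epsilon>\<^sup>2 / 4 * L\<^sup>2"
      using \<theta> by (intro mult_right_mono) auto
    moreover have "0 \<le> \<epsilon>\<^sup>2 * L\<^sup>2" by simp
    ultimately show ?thesis using G_eq[OF us] sq H H0 by linarith
  next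
    assume "\<gamma> * L \<le> j"
    then have "\<gamma> * L * ((1 - \<alpha>) * L / 2) \<le> j * ((1 - \<alpha>) * L / 2)"
      using \<alpha> L by (intro mult_right_mono) auto
    moreover have "8 * \<theta> * L\<^sup>2 \<le> \<gamma> * (1 - \<alpha>) / 2 * L\<^sup>2"
      using \<theta> by (intro mult_right_mono) auto
    moreover have "\<gamma> * L * ((1 - \<alpha>) * L / 2) = \<gamma> * (1 - \<alpha>) / 2 * L\<^sup>2"
      by (simp add: power2_eq_square)
    ultimately show ?thesis using G_le H by linarith
  qed
  \<comment> \<open>Of eight multiples of \<open>\<theta> * L^2\<close>, one was lost in
    \<open>sq\<close> and one goes to \<open>\<theta> * L * u\<close>; six remain.\<close>
  then show ?thesis unfolding split using U by linarith
qed

text \<open>An addition raises \<open>card K\<close> and \<open>card (K \<inter> PC)\<close> by at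
  most one each, so a process of additions enters the bad set with one threshold met exactly and
  neither exceeded. The cap \<open>J\<close> also supplies the assumption
  \<open>j \<le> \<gamma> * L + 1\<close> of \<open>exponent_bound\<close>.\<close>

definition targets :: "nat \<Rightarrow> nat set \<Rightarrow> nat \<Rightarrow> nat \<Rightarrow> nat set set" where
  "targets n PC m J = {K. K \<subseteq> {..<n} \<and> card K \<le> m \<and> card (K \<inter> PC) \<le> J \<and>
     (card K = m \<or> card (K \<inter> PC) = J)}"

text \<open>The targets are grouped by \<open>i = card K\<close> and
  \<open>j = card (K \<inter> PC)\<close>. There are at most \<open>(m + 1) * (J + 1)\<close>
  groups, and \<open>exponent_bound\<close> controls each of them.\<close>

lemma sum_targets_le:
  fixes \<alpha> \<epsilon> \<gamma> \<theta> :: real and n s m J :: nat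
  defines "L \<equiv> log 2 (real n)"
  assumes n: "2 \<le> n" and PC: "PC \<subseteq> {..<n}" "real (card PC) \<le> real n powr \<alpha>"
    and L: "2 \<le> \<epsilon> * L"
    and \<alpha>: "0 \<le> \<alpha>" "\<alpha> < 1" and \<gamma>: "0 < \<gamma>" "\<gamma> \<le> 1 - \<alpha>"
    and \<theta>: "0 \<le> \<theta>" "\<theta> \<le> 1" "8 * \<theta> \<le> \<epsilon>\<^sup>2 / 4" "8 * \<theta> \<le> \<gamma> * (1 - \<alpha>) / 2"
    and s: "s = nat \<lfloor>(1 - \<theta>) * L\<rfloor>" and m: "m = nat \<lceil>(1 + \<epsilon>) * L\<rceil>" and J: "J = nat \<lceil>\<gamma> * L\<rceil>"
  shows "(\<Sum>K\<in>targets n PC m J. (\<Prod>l<card K. step_weight n \<theta> s l) *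
      (1 / 2) ^ ((card K choose 2) - (card (K \<inter> PC) choose 2)))
    \<le> (real m + 1) * (real J + 1) * 2 powr (4 - 6 * \<theta> * L\<^sup>2)"
proof -
  let ?b = "step_weight n \<theta> s"
  let ?g = "\<lambda>i j. (\<Prod>l<i. ?b l) * (1 / 2) ^ ((i choose 2) - (j choose 2))"
  let ?N = "\<lambda>i j. {K. K \<subseteq> {..<n} \<and> card K = i \<and> card (K \<inter> PC) = j}"
  let ?B = "2 powr (4 - 6 * \<theta> * L\<^sup>2)"
  let ?Q = "{(i, j). i \<le> m \<and> j \<le> J \<and> (i = m \<or> j = J)}"
  have n2L: "real n = 2 powr L" using n by (simp add: L_def)
  have L1: "1 \<le> L" using n by (simp add: L_def le_log_iff)
  have finQ: "finite ?Q" by (rule finite_subset[of _ "{..m} \<times> {..J}"]) auto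
  have term_le: "real (card (?N i j)) * ?g i j \<le> ?B" if ij: "i \<le> m" "j \<le> J" "i = m \<or> j = J" for i j
  proof (cases "j \<le> i")
    case True
    let ?u = "min s i"
    have "real (card (?N i j)) \<le> real (card PC ^ j * card {..<n} ^ (i - j))"
      using card_subsets_meeting_le[of "{..<n}" PC j i] PC True by (simp only: of_nat_le_iff finite_lessThan)
    also have "\<dots> = real (card PC) ^ j * real n ^ (i - j)" by simp
    also have "\<dots> \<le> (2 powr (\<alpha> * L)) ^ j * (2 powr L) ^ (i - j)"
      using PC(2) unfolding n2L by (intro mult_mono power_mono) (auto simp: powr_powr mult_ac)
    also have "\<dots> = 2 powr (\<alpha> * L * real j + L * (real i - real j))"
      using True by (simp add: powr_add powr_realpow[symmetric] powr_powr of_nat_diff)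
    finally have 1: "real (card (?N i j)) \<le> 2 powr (\<alpha> * L * real j + L * (real i - real j))" .
    have "(j choose 2) \<le> (i choose 2)"
      using True by (rule binomial_right_mono)
    then have 2: "(1 / 2 :: real) ^ ((i choose 2) - (j choose 2)) =
        2 powr (- (real (i choose 2) - real (j choose 2)))"
      by (simp add: half_power of_nat_diff)
    \<comment> \<open>From \<open>s\<close> on the step weights are 1, which truncates the product
      at \<open>min s i\<close>.\<close>
    have "(\<Prod>l<i. ?b l) = (\<Prod>l<?u. ?b l)"
      by (intro prod.mono_neutral_right) (auto simp: step_weight_def)
    also have "\<dots> = (\<Prod>l<?u. 2 ^ l * 2 powr (L * (\<theta> - 1)))"
      by (intro prod.cong) (auto simp: step_weight_def n2L powr_powr)
    also have "\<dots> = 2 powr (real (?u choose 2) + real ?u * (L * (\<theta> - 1)))"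
      by (rule prod_two_powr)
    finally have 3: "(\<Prod>l<i. ?b l) = \<dots>" .
    have "real (card (?N i j)) * ?g i j \<le> 2 powr (\<alpha> * L * real j + L * (real i - real j)) *
        (2 powr (real (?u choose 2) + real ?u * (L * (\<theta> - 1))) * 2 powr (- (real (i choose 2) - real (j choose 2))))"
      unfolding 2 3 by (intro mult_right_mono 1) auto
    also have "\<dots> = 2 powr (\<alpha> * L * real j + L * (real i - real j) - (real (i choose 2) - real (j choose 2)) +
        (real (?u choose 2) + real ?u * (L * (\<theta> - 1))))"
      unfolding powr_add[symmetric] by (rule arg_cong[where f = "(powr) 2"]) simp
    also have "\<dots> \<le> ?B"
    proof (intro powr_mono)
      have jJ: "real j \<le> \<gamma> * L + 1"
      proof -
        have "0 \<le> \<gamma> * L" using \<gamma> L1 by simp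
        then have "real J = of_int \<lceil>\<gamma> * L\<rceil>" unfolding J by simp
        then show ?thesis using ij(2) by linarith
      qed
      have hit: "(1 + \<epsilon>) * L \<le> real i \<or> \<gamma> * L \<le> real j"
        using ij(3) unfolding m J by (auto simp: real_nat_ceiling_ge)
      have sL: "0 \<le> (1 - \<theta>) * L" using \<theta> L1 by simp
      have "real s = of_int \<lfloor>(1 - \<theta>) * L\<rfloor>" using sL by (simp add: s)
      then have s': "(1 - \<theta>) * L - 1 \<le> real s" "real s \<le> (1 - \<theta>) * L" by linarith+
      show "\<alpha> * L * real j + L * (real i - real j) - (real (i choose 2) - real (j choose 2)) +
        (real (?u choose 2) + real ?u * (L * (\<theta> - 1))) \<le> 4 - 6 * \<theta> * L\<^sup>2"
        unfolding real_choose_2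
        by (rule exponent_bound[OF L1 L \<alpha> \<gamma> \<theta> _ s' _ _ jJ _ hit]) auto
    qed simp
    finally show ?thesis .
  next
    case False
    have "card (K \<inter> PC) \<le> card K" if "K \<subseteq> {..<n}" for K
      using that finite_subset[OF that] by (intro card_mono) auto
    then have none: "?N i j = {}" using False by fastforce
    show ?thesis unfolding none by simp
  qed
  have inner: "(\<Sum>K\<in>?N i j. ?g (card K) (card (K \<inter> PC))) = real (card (?N i j)) * ?g i j" for i j
  proof -
    have "(\<Sum>K\<in>?N i j. ?g (card K) (card (K \<inter> PC))) = (\<Sum>K\<in>?N i j. ?g i j)"
      by (rule sum.cong[OF refl]) auto
    then show ?thesis by simp
  qed
  have "(\<Sum>K\<in>targets n PC m J. ?g (card K) (card (K \<inter> PC))) =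
      (\<Sum>K\<in>(\<Union>q\<in>?Q. case q of (i, j) \<Rightarrow> ?N i j). ?g (card K) (card (K \<inter> PC)))"
    by (rule sum.cong[OF _ refl]) (auto simp: targets_def)
  also have "\<dots> = (\<Sum>q\<in>?Q. \<Sum>K\<in>(case q of (i, j) \<Rightarrow> ?N i j). ?g (card K) (card (K \<inter> PC)))"
    using finQ by (intro sum.UNION_disjoint) auto
  also have "\<dots> = (\<Sum>q\<in>?Q. case q of (i, j) \<Rightarrow> real (card (?N i j)) * ?g i j)"
    by (rule sum.cong[OF refl]) (auto simp only: inner split: prod.split)
  also have "\<dots> \<le> (\<Sum>q\<in>?Q. ?B)"
    by (rule sum_mono) (use term_le in \<open>auto split: prod.split\<close>)
  also have "\<dots> = real (card ?Q) * ?B"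
    by (simp only: sum_constant)
  also have "\<dots> \<le> (real m + 1) * (real J + 1) * ?B"
  proof (rule mult_right_mono)
    have "card ?Q \<le> card ({..m} \<times> {..J})"
      by (rule card_mono) auto
    also have "\<dots> = (m + 1) * (J + 1)"
      by (simp add: card_cartesian_product)
    finally have "real (card ?Q) \<le> real ((m + 1) * (J + 1))"
      by (simp only: of_nat_le_iff)
    then show "real (card ?Q) \<le> (real m + 1) * (real J + 1)"
      by (simp only: of_nat_mult of_nat_add of_nat_1)
  qed simp
  finally show ?thesis .
qed

section \<open>Good graphs\<close>

text \<open>The deterministic part: \<open>nb\<close> and \<open>W\<close> are the two graph
  properties that make the potential bound work for every small starting clique. \<open>nb\<close>
  concerns the base graph alone, since common neighbours in \<open>E\<close> of a clique of
  \<open>E'\<close> still extend it in \<open>E'\<close>.\<close>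

lemma good_graph_reach_prob_le:
  fixes \<epsilon> \<gamma> \<theta> \<beta> :: real and n s m J T :: nat
  defines "L \<equiv> log 2 (real n)"
  assumes n: "2 \<le> n" and \<beta>: "0 \<le> \<beta>"
    and \<epsilon>: "0 < \<epsilon>" and \<gamma>: "0 < \<gamma>" and \<theta>: "0 \<le> \<theta>" "\<theta> \<le> 1" "\<theta> < \<gamma>"
    and m: "m = nat \<lceil>(1 + \<epsilon>) * L\<rceil>" and J: "J = nat \<lceil>\<gamma> * L\<rceil>"
    and E': "E' = E \<union> nsets PC 2"
    and nb: "\<And>X. X \<subseteq> {..<n} \<Longrightarrow> card X < s \<Longrightarrow>
      nat \<lfloor>real n powr (1 - \<theta>) / 2 ^ card X\<rfloor> < card (common_neighbours n E X)"
    and W: "(\<Sum>K\<in>targets n PC m J \<inter> cliques n E'. \<Prod>l<card K. step_weight n \<theta> s l) \<le> w"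
    and C: "C \<in> cliques n E'" "real (card C) \<le> \<theta> * L"
  shows "reach_prob (metropolis n E' \<beta>) C T
      {C'. real (card C') \<ge> (1 + \<epsilon>) * L \<or> real (card (C' \<inter> PC)) \<ge> \<gamma> * L}
    \<le> real m ^ m * (2 powr (\<theta> * L\<^sup>2) * w) + real T * exp (- \<beta>)"
proof -
  let ?A = "{C'. real (card C') \<ge> (1 + \<epsilon>) * L \<or> real (card (C' \<inter> PC)) \<ge> \<gamma> * L}"
  let ?KK = "targets n PC m J \<inter> cliques n E'" and ?b = "step_weight n \<theta> s"
  have n2L: "real n = 2 powr L" using n by (simp add: L_def)
  have L1: "1 \<le> L" using n by (simp add: L_def le_log_iff)
  have ge_m: "m \<le> c \<longleftrightarrow> (1 + \<epsilon>) * L \<le> real c" for c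
    unfolding m nat_le_iff ceiling_le_iff by simp
  have ge_J: "J \<le> c \<longleftrightarrow> \<gamma> * L \<le> real c" for c
    unfolding J nat_le_iff ceiling_le_iff by simp
  have m0: "0 < m"
  proof -
    have "0 < (1 + \<epsilon>) * L" using \<epsilon> L1 by simp
    then show ?thesis using ge_m[of 0] by (simp add: not_le)
  qed
  have CA: "C \<notin> ?A"
  proof -
    have "card (C \<inter> PC) \<le> card C"
      using C(1) by (intro card_mono) (auto dest: finite_clique)
    moreover have "\<theta> * L < \<gamma> * L" "\<theta> * L < (1 + \<epsilon>) * L"
      using L1 \<theta> \<epsilon> by (auto intro: mult_strict_right_mono)
    ultimately show ?thesis using C(2) by auto
  qed
  have "reach_prob (metropolis n E' \<beta>) C T ?A \<le> potential ?b ?KK C + real T * exp (- \<beta>)"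
  proof (rule reach_prob_le_potential)
    show "0 \<le> ?b l" for l by (simp add: step_weight_def)
    show "1 \<le> real (card (extensions n E' X)) * ?b (card X)"
      if X: "X \<in> cliques n E'" "extensions n E' X \<noteq> {}" for X
    proof (cases "card X < s")
      case True
      let ?c = "real n powr (1 - \<theta>) / 2 ^ card X"
      have Xn: "X \<subseteq> {..<n}" using X by (simp add: cliques_def)
      have "common_neighbours n E X \<subseteq> extensions n E' X"
        using X(1) by (auto simp: common_neighbours_def extensions_def cliques_def clique_def E' insert_commute)
      then have "card (common_neighbours n E X) \<le> card (extensions n E' X)"
        by (intro card_mono) auto
      \<comment> \<open>A cardinality strictly above the floor of \<open>?c\<close> is at least
        \<open>?c\<close> itself.\<close>
      then have "?c \<le> real (card (extensions n E' X))"
        using nb[OF Xn True] by linarith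
      then have "?c * ?b (card X) \<le> real (card (extensions n E' X)) * ?b (card X)"
        by (intro mult_right_mono) (auto simp: step_weight_def)
      moreover have "?c * ?b (card X) = 1"
        using True n by (simp add: step_weight_def flip: powr_add)
      ultimately show ?thesis by metis
    next
      case False
      have "1 \<le> card (extensions n E' X)" using X by (simp add: Suc_le_eq card_gt_0_iff)
      then show ?thesis using False by (simp add: step_weight_def)
    qed
    fix X v
    assume X: "X \<in> cliques n E'" "X \<notin> ?A" "v \<in> extensions n E' X" "insert v X \<in> ?A"
    have "finite X" using X(1) by (rule finite_clique)
    then have c: "card (insert v X) = Suc (card X)" "card (insert v X \<inter> PC) \<le> Suc (card (X \<inter> PC))"
      using X(3) by (auto simp: extensions_def Int_insert_left card_insert_if)
    have clq: "insert v X \<in> cliques n E'" using X(3) by (simp add: extensions_def)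
    have "card X < m" "card (X \<inter> PC) < J"
      using X(2) by (auto simp: not_le[symmetric] ge_m ge_J)
    moreover have "m \<le> card (insert v X) \<or> J \<le> card (insert v X \<inter> PC)"
      using X(4) by (simp only: ge_m ge_J mem_Collect_eq)
    ultimately show "insert v X \<in> ?KK"
      using c clq by (auto simp: targets_def cliques_def)
  qed (use n \<beta> C CA in auto)
  also have "potential ?b ?KK C \<le> real m ^ m * real n ^ card C * (\<Sum>K\<in>?KK. \<Prod>l<card K. ?b l)"
    using n m0 \<theta> by (intro potential_le step_weight_ge) (auto simp: targets_def)
  also have "\<dots> \<le> real m ^ m * (2 powr (\<theta> * L\<^sup>2) * w)"
  proof -
    \<comment> \<open>The price of a nonempty starting clique is one of the six multiples of
      \<open>\<theta> * L^2\<close> gained in \<open>exponent_bound\<close>.\<close>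
    have "real n ^ card C = 2 powr (L * real (card C))"
      unfolding n2L by (simp add: powr_powr powr_realpow[of "2 powr L", symmetric])
    also have "\<dots> \<le> 2 powr (L * (\<theta> * L))"
      using C(2) L1 by (intro powr_mono mult_left_mono) auto
    also have "L * (\<theta> * L) = \<theta> * L\<^sup>2" by (simp add: power2_eq_square)
    finally have "real n ^ card C \<le> 2 powr (\<theta> * L\<^sup>2)" .
    then show ?thesis unfolding mult.assoc
      by (intro mult_left_mono mult_mono W sum_nonneg prod_nonneg) (auto simp: step_weight_def)
  qed
  finally show ?thesis by simp
qed

text \<open>Let \<open>p = (1 / 2) ^ i\<close>. At least \<open>n / 2\<close> vertices lie outside
  \<open>X\<close> and \<open>S\<close>, so one pair is bad with probability at most
  \<open>exp (- p * n / 2)\<close>, while the choice of \<open>S\<close> costs at most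
  \<open>exp (p * n / 4)\<close>. This leaves \<open>exp (- p * n / 4)\<close>, where
  \<open>p \<ge> n powr (\<theta> - 1)\<close> because \<open>i < s\<close>. The choice of
  \<open>X\<close> accounts for the term \<open>L * ln n\<close>.\<close>

lemma prob_few_common_neighbours_le:
  fixes \<theta> :: real and n s :: nat
  defines "L \<equiv> log 2 (real n)"
  assumes n: "2 \<le> n" and \<theta>: "0 \<le> \<theta>" "\<theta> \<le> 1" and s: "real s \<le> (1 - \<theta>) * L"
    and large: "L + real n powr (1 - \<theta>) \<le> real n / 2" "real n powr (1 - \<theta>) * ln (real n) \<le> real n / 4"
  shows "measure_pmf.prob (gnp_half n) {E. \<exists>X\<subseteq>{..<n}. card X < s \<and>
      card (common_neighbours n E X) \<le> nat \<lfloor>real n powr (1 - \<theta>) / 2 ^ card X\<rfloor>}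
    \<le> real n * exp (L * ln (real n) - real n powr \<theta> / 4)"
proof -
  let ?a = "\<lambda>i. nat \<lfloor>real n powr (1 - \<theta>) / 2 ^ i\<rfloor>"
  have n2L: "real n = 2 powr L" using n by (simp add: L_def)
  have L1: "1 \<le> L" using n by (simp add: L_def le_log_iff)
  have lnn: "0 \<le> ln (real n)" using n by simp
  have "(1 - \<theta>) * L \<le> L" using \<theta> L1 mult_right_mono[of "1 - \<theta>" 1 L] by simp
  then have sL: "real s \<le> L" using s by simp
  have sn: "real s \<le> real n" using sL large(1) powr_ge_zero[of "real n" "1 - \<theta>"] by linarith
  have a: "real (?a i) \<le> real n powr (1 - \<theta>) * (1 / 2) ^ i" for i
  proof -
    have "real (?a i) \<le> real n powr (1 - \<theta>) / 2 ^ i" by (rule of_nat_floor) simp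
    then show ?thesis by (simp add: power_one_over)
  qed
  have a': "real (?a i) \<le> real n powr (1 - \<theta>)" for i
    using a[of i] mult_left_mono[of "(1 / 2 :: real) ^ i" 1 "real n powr (1 - \<theta>)"]
    by (simp add: power_le_one)
  have "measure_pmf.prob (gnp_half n) {E. \<exists>X\<subseteq>{..<n}. card X < s \<and> card (common_neighbours n E X) \<le> ?a (card X)}
     \<le> (\<Sum>i<s. real n ^ (i + ?a i) * (1 - (1 / 2) ^ i) ^ (n - i - ?a i))"
  proof (rule prob_few_common_neighbours)
    show "?a i \<le> n" for i
      using a'[of i] large L1 by linarith
  qed
  also have "\<dots> \<le> (\<Sum>i<s. exp (L * ln (real n) - real n powr \<theta> / 4))"
  proof (intro sum_mono)
    fix i assume "i \<in> {..<s}"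
    then have i: "real i \<le> (1 - \<theta>) * L" "real i \<le> L" using s sL by auto
    define p :: real where "p = (1 / 2) ^ i"
    have p: "0 < p" "p \<le> 1" by (simp_all add: p_def power_le_one)
    have "real n powr (\<theta> - 1) \<le> p"
    proof -
      have "real n powr (\<theta> - 1) = 2 powr - ((1 - \<theta>) * L)"
        by (simp add: n2L powr_powr algebra_simps)
      also have "\<dots> \<le> 2 powr - real i" using i by (intro powr_mono) auto
      also have "\<dots> = p" by (simp only: p_def half_power)
      finally show ?thesis .
    qed
    then have "real n powr (\<theta> - 1) * (real n / 4) \<le> p * (real n / 4)"
      by (intro mult_right_mono) auto
    moreover have "real n powr (\<theta> - 1) * (real n / 4) = real n powr \<theta> / 4"
      using n by (simp add: powr_diff)
    ultimately have pn: "real n powr \<theta> / 4 \<le> p * (real n / 4)" by simp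
    have "real (i + ?a i) \<le> real n / 2" using a'[of i] i large by simp
    then have N: "real n / 2 \<le> real (n - i - ?a i)" by linarith
    have "real n ^ (i + ?a i) * (1 - p) ^ (n - i - ?a i) \<le>
        exp (ln (real n) * real (i + ?a i)) * exp (- p * real (n - i - ?a i))"
    proof (intro mult_mono)
      show "real n ^ (i + ?a i) \<le> exp (ln (real n) * real (i + ?a i))"
        using n by (simp only: exp_of_nat2_mult) (simp add: exp_ln)
      have "(1 - p) ^ (n - i - ?a i) \<le> exp (- p) ^ (n - i - ?a i)"
        using p exp_ge_add_one_self[of "- p"] by (intro power_mono) auto
      then show "(1 - p) ^ (n - i - ?a i) \<le> exp (- p * real (n - i - ?a i))"
        by (simp only: exp_of_nat2_mult)
    qed (use p in auto)
    also have "\<dots> = exp (ln (real n) * real (i + ?a i) - p * real (n - i - ?a i))"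
      by (simp flip: exp_add)
    also have "\<dots> \<le> exp (L * ln (real n) - real n powr \<theta> / 4)"
    proof -
      have "ln (real n) * real i \<le> ln (real n) * L" using i lnn by (intro mult_left_mono)
      moreover have "ln (real n) * real (?a i) \<le> ln (real n) * (real n powr (1 - \<theta>) * p)"
        using a[of i] lnn unfolding p_def by (intro mult_left_mono)
      moreover have "p * (real n powr (1 - \<theta>) * ln (real n)) \<le> p * (real n / 4)"
        using large p by (intro mult_left_mono) auto
      moreover have "p * (real n / 2) \<le> p * real (n - i - ?a i)"
        using N p by (intro mult_left_mono) auto
      ultimately show ?thesis using pn by (simp add: algebra_simps)
    qed
    finally show "real n ^ (i + ?a i) * (1 - (1 / 2) ^ i) ^ (n - i - ?a i) \<le>
      exp (L * ln (real n) - real n powr \<theta> / 4)" unfolding p_def .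
  qed
  also have "\<dots> \<le> real n * exp (L * ln (real n) - real n powr \<theta> / 4)"
    using sn by simp
  finally show ?thesis .
qed

lemma prob_clique_weight_ge:
  assumes "0 < B" "0 < n" "0 < c" and g: "\<And>K. 0 \<le> g K" and T: "T \<subseteq> Pow {..<n}"
    and le: "(\<Sum>K\<in>T. g K * (1 / 2) ^ ((card K choose 2) - (card (K \<inter> PC) choose 2))) \<le> B"
  shows "measure_pmf.prob (gnp_half n) {E. \<not> (\<Sum>K\<in>T \<inter> cliques n (E \<union> nsets PC 2). g K) \<le> c * B} \<le> 1 / (c :: real)"
proof -
  let ?W = "\<lambda>E. \<Sum>K\<in>T \<inter> cliques n (E \<union> nsets PC 2). g K"
  have "measure_pmf.prob (gnp_half n) {E. \<not> ?W E \<le> c * B} \<le>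
      measure_pmf.prob (gnp_half n) {E \<in> space (measure_pmf (gnp_half n)). c * B \<le> ?W E}"
    by (intro measure_pmf.finite_measure_mono) auto
  also have "\<dots> \<le> measure_pmf.expectation (gnp_half n) ?W / (c * B)"
    using assms by (intro integral_Markov_inequality_measure[where A = UNIV] integrable_gnp_half)
      (auto intro!: sum_nonneg)
  also have "\<dots> \<le> B / (c * B)"
    unfolding expectation_weighted_clique_count[OF T]
    using assms by (intro divide_right_mono) auto
  finally show ?thesis using assms by simp
qed

section \<open>Asymptotics of the failure probability\<close>

definition failure_bound :: "real \<Rightarrow> real \<Rightarrow> real \<Rightarrow> nat \<Rightarrow> real" where
  "failure_bound \<epsilon> \<gamma> \<theta> n = (let L = log 2 (real n); m = nat \<lceil>(1 + \<epsilon>) * L\<rceil>; J = nat \<lceil>\<gamma> * L\<rceil> in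
     real m ^ m * (2 powr (\<theta> * L\<^sup>2) *
       (real n * ((real m + 1) * (real J + 1) * 2 powr (4 - 6 * \<theta> * L\<^sup>2)))))"

text \<open>The estimates \<open>m \<le> 3 * L\<close> and \<open>J \<le> L + 1\<close> remove the
  rounding and leave a smooth expression in \<open>L\<close> alone, ready for asymptotic
  comparison.\<close>

lemma failure_bound_le:
  assumes n: "2 \<le> n" and \<epsilon>: "0 < \<epsilon>" "\<epsilon> < 1" and \<gamma>: "0 < \<gamma>" "\<gamma> \<le> 1"
  defines "L \<equiv> log 2 (real n)"
  shows "failure_bound \<epsilon> \<gamma> \<theta> n \<le>
    (3 * L) powr (3 * L) * (2 powr L * ((3 * L + 1) * (L + 2)) * 2 powr (4 - 5 * \<theta> * L\<^sup>2))"
proof -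
  define m J where "m = nat \<lceil>(1 + \<epsilon>) * L\<rceil>" and "J = nat \<lceil>\<gamma> * L\<rceil>"
  have n2L: "real n = 2 powr L" using n by (simp add: L_def)
  have L1: "1 \<le> L" using n by (simp add: L_def le_log_iff)
  have pos: "0 < (1 + \<epsilon>) * L" "0 < \<gamma> * L" using \<epsilon> \<gamma> L1 by simp_all
  have "real m = of_int \<lceil>(1 + \<epsilon>) * L\<rceil>" "real J = of_int \<lceil>\<gamma> * L\<rceil>"
    using pos by (simp_all add: m_def J_def)
  moreover have "(1 + \<epsilon>) * L \<le> 2 * L" "\<gamma> * L \<le> 1 * L"
    using \<epsilon> \<gamma> L1 by (intro mult_right_mono; simp)+
  ultimately have m: "0 < real m" "real m \<le> 3 * L" and J: "real J \<le> L + 1"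
    using pos L1 by linarith+
  have "real m ^ m = real m powr real m" using m by (simp add: powr_realpow)
  also have "\<dots> \<le> (3 * L) powr real m" using m by (intro powr_mono2) auto
  also have "\<dots> \<le> (3 * L) powr (3 * L)" using m L1 by (intro powr_mono) auto
  finally have mm: "real m ^ m \<le> (3 * L) powr (3 * L)" .
  have mJ: "(real m + 1) * (real J + 1) \<le> (3 * L + 1) * (L + 2)"
    using m J L1 by (intro mult_mono) auto
  have "failure_bound \<epsilon> \<gamma> \<theta> n = real m ^ m * (2 powr L * ((real m + 1) * (real J + 1)) *
      (2 powr (\<theta> * L\<^sup>2) * 2 powr (4 - 6 * \<theta> * L\<^sup>2)))"
  proof -
    have "failure_bound \<epsilon> \<gamma> \<theta> n = real m ^ m * (2 powr (\<theta> * L\<^sup>2) *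
        (real n * ((real m + 1) * (real J + 1) * 2 powr (4 - 6 * \<theta> * L\<^sup>2))))"
      by (simp only: failure_bound_def Let_def L_def m_def J_def)
    then show ?thesis unfolding n2L by (simp only: mult_ac)
  qed
  also have "2 powr (\<theta> * L\<^sup>2) * 2 powr (4 - 6 * \<theta> * L\<^sup>2) = 2 powr (4 - 5 * \<theta> * L\<^sup>2)"
    unfolding powr_add[symmetric] by (rule arg_cong[where f = "(powr) 2"]) simp
  also have "real m ^ m * (2 powr L * ((real m + 1) * (real J + 1)) * 2 powr (4 - 5 * \<theta> * L\<^sup>2)) \<le>
      (3 * L) powr (3 * L) * (2 powr L * ((3 * L + 1) * (L + 2)) * 2 powr (4 - 5 * \<theta> * L\<^sup>2))"
    using L1 by (intro mult_mono[OF mm] mult_right_mono mult_left_mono mJ) auto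
  finally show ?thesis .
qed

text \<open>The factor \<open>2 powr (4 - 5 * \<theta> * L^2)\<close> decays faster than every
  \<open>n powr (- D) = 2 powr (- D * L)\<close>; the other factors are only 2 to the power of order
  \<open>L * log L\<close>.\<close>

lemma superpoly_small_failure_bound:
  assumes \<epsilon>: "0 < \<epsilon>" "\<epsilon> < 1" and \<gamma>: "0 < \<gamma>" "\<gamma> \<le> 1" and \<theta>: "0 < \<theta>"
  shows "superpoly_small (failure_bound \<epsilon> \<gamma> \<theta>)"
  unfolding superpoly_small_def
proof (intro allI impI)
  fix D :: real assume D: "0 < D"
  have "\<forall>\<^sub>F L in at_top. (3 * L) powr (3 * L) * (2 powr L * ((3 * L + 1) * (L + 2)) * 2 powr (4 - 5 * \<theta> * L\<^sup>2))
      \<le> 2 powr (L * (- D))"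
    using \<theta> D by real_asymp
  moreover have "filterlim (\<lambda>n. log 2 (real n)) at_top sequentially" by real_asymp
  ultimately have "\<forall>\<^sub>F n in sequentially. (3 * log 2 (real n)) powr (3 * log 2 (real n)) *
      (2 powr log 2 (real n) * ((3 * log 2 (real n) + 1) * (log 2 (real n) + 2)) *
        2 powr (4 - 5 * \<theta> * (log 2 (real n))\<^sup>2)) \<le> 2 powr (log 2 (real n) * (- D))"
    by (rule eventually_compose_filterlim)
  then show "\<forall>\<^sub>F n in sequentially. failure_bound \<epsilon> \<gamma> \<theta> n \<le> real n powr (- D)"
    using eventually_ge_at_top[of 2]
  proof eventually_elim
    case (elim n)
    have "2 powr (log 2 (real n) * (- D)) = real n powr (- D)"
      using elim(2) by (subst powr_powr[symmetric]) simp
    then show ?case using failure_bound_le[OF elim(2) \<epsilon> \<gamma>, of \<theta>] elim(1) by linarith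
  qed
qed

lemma superpoly_small_add:
  assumes "superpoly_small f" "superpoly_small g"
  shows "superpoly_small (\<lambda>n. f n + g n)"
  unfolding superpoly_small_def
proof (intro allI impI)
  fix D :: real assume D: "0 < D"
  \<comment> \<open>The exponent \<open>D + 1\<close> leaves a spare factor \<open>n\<close> to
    absorb the 2 from the sum.\<close>
  have "\<forall>\<^sub>F n in sequentially. f n \<le> real n powr (- (D + 1))"
    "\<forall>\<^sub>F n in sequentially. g n \<le> real n powr (- (D + 1))"
    using assms D unfolding superpoly_small_def by (meson add_pos_pos zero_less_one)+
  moreover have "\<forall>\<^sub>F n in sequentially. 2 * real n powr (- (D + 1)) \<le> real n powr (- D)"
    by real_asymp
  ultimately show "\<forall>\<^sub>F n in sequentially. f n + g n \<le> real n powr (- D)"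
    by eventually_elim linarith
qed

text \<open>Eventually \<open>\<beta> n \<ge> (c + D) * log 2 n \<ge> (c + D) * ln n\<close>, which
  beats the number \<open>n ^ c\<close> of steps with \<open>n powr (- D)\<close> to spare.\<close>

lemma superpoly_small_removal:
  assumes "filterlim (\<lambda>n. \<beta> n / log 2 (real n)) at_top sequentially"
  shows "superpoly_small (\<lambda>n. real (n ^ c) * exp (- \<beta> n))"
  unfolding superpoly_small_def
proof (intro allI impI)
  fix D :: real assume D: "0 < D"
  have "\<forall>\<^sub>F n in sequentially. real c + D \<le> \<beta> n / log 2 (real n)"
    using assms by (simp add: filterlim_at_top)
  then show "\<forall>\<^sub>F n in sequentially. real (n ^ c) * exp (- \<beta> n) \<le> real n powr (- D)"
    using eventually_ge_at_top[of 2]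
  proof eventually_elim
    case (elim n)
    have ln_le: "0 < ln (real n)" "ln (real n) \<le> log 2 (real n)"
      using elim(2) ln_2_less_1 by (auto simp: log_def field_simps)
    have "(real c + D) * ln (real n) \<le> (real c + D) * log 2 (real n)"
      using ln_le D by (intro mult_left_mono) auto
    also have "\<dots> \<le> \<beta> n" using elim(1) ln_le by (simp add: field_simps)
    finally have "real c * ln (real n) - \<beta> n \<le> - D * ln (real n)" by (simp add: algebra_simps)
    then have "exp (real c * ln (real n) - \<beta> n) \<le> exp (- D * ln (real n))" by simp
    moreover have "exp (real c * ln (real n) - \<beta> n) = real (n ^ c) * exp (- \<beta> n)"
      using elim(2) by (simp add: exp_diff exp_minus exp_of_nat_mult divide_inverse)
    moreover have "exp (- D * ln (real n)) = real n powr (- D)"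
      using elim(2) by (simp add: powr_def)
    ultimately show ?case by simp
  qed
qed

text \<open>\<open>\<delta>\<close> is chosen before the graph and the starting clique, so the
  failure bound is uniform in both. \<open>c\<close> can be quantified inside the event because the
  two graph properties behind it do not involve \<open>c\<close>.\<close>

theorem theorem7p7:
  fixes \<alpha> \<epsilon> \<gamma> :: real
  assumes "0 \<le> \<alpha>" and "\<alpha> < 1"
    and "0 < \<epsilon>" and "\<epsilon> < 1"
    and "0 < \<gamma>" and "\<gamma> \<le> 1 - \<alpha>"
  shows "\<exists>\<xi>>0. \<forall>\<beta> :: nat \<Rightarrow> real.
    filterlim (\<lambda>n. \<beta> n / log 2 (real n)) at_top sequentially \<longrightarrow>
    (\<exists>\<delta> :: nat \<Rightarrow> nat \<Rightarrow> real.
      (\<forall>c\<ge>1. superpoly_small (\<delta> c)) \<and>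
      (\<lambda>n. measure_pmf.prob (planted_clique n (nat \<lfloor>real n powr \<alpha>\<rfloor>))
         {(E, PC). \<forall>C\<in>cliques n E. real (card C) \<le> \<xi> * log 2 (real n) \<longrightarrow>
            (\<forall>c\<ge>1. 1 - reach_prob (metropolis n E (\<beta> n)) C (n ^ c)
               {C'. real (card C') \<ge> (1 + \<epsilon>) * log 2 (real n) \<or>
                    real (card (C' \<inter> PC)) \<ge> \<gamma> * log 2 (real n)}
             \<ge> 1 - \<delta> c n)}) \<longlonglongrightarrow> 1)"
proof -
  \<comment> \<open>\<open>\<theta>\<close> also serves as \<open>\<xi>\<close>. The divisor 8
    provides eight multiples of \<open>\<theta> * L^2\<close>: three pay for stopping at
    \<open>s\<close>, for the loss in the step weights and for the starting clique, and five remain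
    in \<open>failure_bound_le\<close>.\<close>
  define \<theta> where "\<theta> = min (\<epsilon>\<^sup>2 / 4) (\<gamma> * (1 - \<alpha>) / 2) / 8"
  have \<gamma>1: "\<gamma> \<le> 1" using assms by simp
  have \<theta>0: "0 < \<theta>" using assms by (simp add: \<theta>_def)
  have \<theta>8: "8 * \<theta> \<le> \<epsilon>\<^sup>2 / 4" "8 * \<theta> \<le> \<gamma> * (1 - \<alpha>) / 2"
    by (simp_all add: \<theta>_def)
  \<comment> \<open>This yields \<open>\<theta> < \<gamma>\<close>, which keeps every admissible
    starting clique outside the bad set.\<close>
  have "\<gamma> * (1 - \<alpha>) \<le> \<gamma> * 1" using assms by (intro mult_left_mono) auto
  then have \<theta>\<gamma>: "\<theta> < \<gamma>" and \<theta>1': "\<theta> < 1" using \<theta>8(2) \<gamma>1 assms by linarith+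
  then have \<theta>1: "\<theta> \<le> 1" by simp
  show ?thesis
  proof (intro exI[of _ \<theta>] conjI \<theta>0 allI impI)
    fix \<beta> :: "nat \<Rightarrow> real"
    assume \<beta>: "filterlim (\<lambda>n. \<beta> n / log 2 (real n)) at_top sequentially"
    define \<delta> where "\<delta> c n = failure_bound \<epsilon> \<gamma> \<theta> n + real (n ^ c) * exp (- \<beta> n)" for c n :: nat
    define good where "good n = (\<lambda>(E, PC). \<forall>C\<in>cliques n E. real (card C) \<le> \<theta> * log 2 (real n) \<longrightarrow>
            (\<forall>c\<ge>1. 1 - reach_prob (metropolis n E (\<beta> n)) C (n ^ c)
               {C'. real (card C') \<ge> (1 + \<epsilon>) * log 2 (real n) \<or>
                    real (card (C' \<inter> PC)) \<ge> \<gamma> * log 2 (real n)}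
             \<ge> 1 - \<delta> c n))" for n
    define \<eta> where "\<eta> n = real n * exp (log 2 (real n) * ln (real n) - real n powr \<theta> / 4) + 1 / real n" for n
    have \<delta>_small: "superpoly_small (\<delta> c)" for c
      unfolding \<delta>_def using assms \<gamma>1 \<theta>0 \<beta>
      by (intro superpoly_small_add superpoly_small_failure_bound superpoly_small_removal)
    have ev: "\<forall>\<^sub>F n in sequentially. 0 \<le> \<beta> n / log 2 (real n)"
      using \<beta> by (simp add: filterlim_at_top)
    have ev2: "\<forall>\<^sub>F n in sequentially. 2 \<le> \<epsilon> * log 2 (real n)"
      using assms by real_asymp
    have ev3: "\<forall>\<^sub>F n in sequentially. log 2 (real n) + real n powr (1 - \<theta>) \<le> real n / 2"
      using \<theta>0 \<theta>1' by real_asymp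
    have ev4: "\<forall>\<^sub>F n in sequentially. real n powr (1 - \<theta>) * ln (real n) \<le> real n / 4"
      using \<theta>0 by real_asymp
    have lower: "\<forall>\<^sub>F n in sequentially. 1 - \<eta> n \<le>
        measure_pmf.prob (planted_clique n (nat \<lfloor>real n powr \<alpha>\<rfloor>)) {x. good n x}"
      using ev ev2 ev3 ev4 eventually_ge_at_top[of 2]
    proof eventually_elim
      case (elim n)
      let ?k = "nat \<lfloor>real n powr \<alpha>\<rfloor>" and ?L = "log 2 (real n)"
      define m where "m = nat \<lceil>(1 + \<epsilon>) * ?L\<rceil>"
      define J where "J = nat \<lceil>\<gamma> * ?L\<rceil>"
      define s where "s = nat \<lfloor>(1 - \<theta>) * ?L\<rfloor>"
      define B where "B = (real m + 1) * (real J + 1) * 2 powr (4 - 6 * \<theta> * ?L\<^sup>2)"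
      have n: "2 \<le> n" by (rule elim)
      have L0: "0 < ?L" using n by simp
      have \<beta>0: "0 \<le> \<beta> n" using elim(1) L0 by (simp add: zero_le_divide_iff)
      have k: "real ?k \<le> real n powr \<alpha>" by simp
      also have "\<dots> \<le> real n powr 1" using n assms by (intro powr_mono) auto
      finally have "?k \<le> n" by simp
      have s: "real s \<le> (1 - \<theta>) * ?L" using \<theta>1 L0 by (simp add: s_def)
      show ?case
      proof (rule prob_planted_clique_ge[OF \<open>?k \<le> n\<close>])
        fix PC assume PC: "PC \<subseteq> {..<n}" "card PC = ?k"
        let ?few = "{E. \<exists>X\<subseteq>{..<n}. card X < s \<and>
          card (common_neighbours n E X) \<le> nat \<lfloor>real n powr (1 - \<theta>) / 2 ^ card X\<rfloor>}"
        \<comment> \<open>The threshold \<open>n * B\<close> makes Markov's inequality fail with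
          probability at most \<open>1 / n\<close>; the extra factor \<open>n\<close> is harmless in
          \<open>failure_bound\<close>.\<close>
        let ?heavy = "{E. \<not> (\<Sum>K\<in>targets n PC m J \<inter> cliques n (E \<union> nsets PC 2).
          \<Prod>l<card K. step_weight n \<theta> s l) \<le> real n * B}"
        have "{E. \<not> good n (E \<union> nsets PC 2, PC)} \<subseteq> ?few \<union> ?heavy"
        proof (rule subsetI, rule ccontr)
          fix E assume bad: "E \<in> {E. \<not> good n (E \<union> nsets PC 2, PC)}" and E: "E \<notin> ?few \<union> ?heavy"
          have "good n (E \<union> nsets PC 2, PC)"
            unfolding good_def prod.case
          proof (intro ballI impI allI)
            fix C c assume C: "C \<in> cliques n (E \<union> nsets PC 2)" "real (card C) \<le> \<theta> * ?L"
            have "reach_prob (metropolis n (E \<union> nsets PC 2) (\<beta> n)) C (n ^ c)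
                {C'. real (card C') \<ge> (1 + \<epsilon>) * ?L \<or> real (card (C' \<inter> PC)) \<ge> \<gamma> * ?L}
              \<le> real m ^ m * (2 powr (\<theta> * ?L\<^sup>2) * (real n * B)) + real (n ^ c) * exp (- \<beta> n)"
            proof (rule good_graph_reach_prob_le[OF n \<beta>0 _ _ _ _ _ m_def J_def refl _ _ C])
              show "nat \<lfloor>real n powr (1 - \<theta>) / 2 ^ card X\<rfloor> < card (common_neighbours n E X)"
                if "X \<subseteq> {..<n}" "card X < s" for X
                using E that by (auto simp: not_le)
              show "(\<Sum>K\<in>targets n PC m J \<inter> cliques n (E \<union> nsets PC 2).
                  \<Prod>l<card K. step_weight n \<theta> s l) \<le> real n * B"
                using E by simp
            qed (use assms \<theta>0 \<theta>1 \<theta>\<gamma> in auto)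
            also have "\<dots> = \<delta> c n"
              by (simp only: \<delta>_def failure_bound_def Let_def B_def m_def J_def)
            finally show "1 - \<delta> c n \<le> 1 - reach_prob (metropolis n (E \<union> nsets PC 2) (\<beta> n)) C (n ^ c)
                {C'. real (card C') \<ge> (1 + \<epsilon>) * ?L \<or> real (card (C' \<inter> PC)) \<ge> \<gamma> * ?L}"
              by simp
          qed
          with bad show False by simp
        qed
        then have "measure_pmf.prob (gnp_half n) {E. \<not> good n (E \<union> nsets PC 2, PC)} \<le>
            measure_pmf.prob (gnp_half n) (?few \<union> ?heavy)"
          by (intro measure_pmf.finite_measure_mono) auto
        also have "\<dots> \<le> measure_pmf.prob (gnp_half n) ?few + measure_pmf.prob (gnp_half n) ?heavy"
          by (rule measure_Un_le) auto
        also have "\<dots> \<le> \<eta> n"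
          unfolding \<eta>_def
        proof (rule add_mono)
          show "measure_pmf.prob (gnp_half n) ?few \<le> real n * exp (?L * ln (real n) - real n powr \<theta> / 4)"
            using n \<theta>0 \<theta>1 s elim by (intro prob_few_common_neighbours_le) auto
          show "measure_pmf.prob (gnp_half n) ?heavy \<le> 1 / real n"
          proof (rule prob_clique_weight_ge)
            show "(\<Sum>K\<in>targets n PC m J. (\<Prod>l<card K. step_weight n \<theta> s l) *
                (1 / 2) ^ ((card K choose 2) - (card (K \<inter> PC) choose 2))) \<le> B"
              unfolding B_def using PC k
              by (intro sum_targets_le[OF n _ _ elim(2) assms(1,2,5,6) less_imp_le[OF \<theta>0] \<theta>1 \<theta>8 s_def m_def J_def]) auto
            show "0 < B" unfolding B_def by (intro mult_pos_pos add_nonneg_pos) auto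
          qed (use n in \<open>auto simp: targets_def step_weight_def intro!: prod_nonneg\<close>)
        qed
        finally show "measure_pmf.prob (gnp_half n) {E. \<not> good n (E \<union> nsets PC 2, PC)} \<le> \<eta> n" .
      qed
    qed
    have \<eta>_lim: "\<eta> \<longlonglongrightarrow> 0"
      unfolding \<eta>_def using \<theta>0 by real_asymp
    have lim: "(\<lambda>n. 1 - \<eta> n) \<longlonglongrightarrow> 1"
      using tendsto_diff[OF tendsto_const[of 1] \<eta>_lim] by simp
    have "(\<lambda>n. measure_pmf.prob (planted_clique n (nat \<lfloor>real n powr \<alpha>\<rfloor>)) {x. good n x}) \<longlonglongrightarrow> 1"
      by (rule tendsto_sandwich[OF lower _ lim tendsto_const]) simp
    then have "(\<forall>c\<ge>1. superpoly_small (\<delta> c)) \<and>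
      (\<lambda>n. measure_pmf.prob (planted_clique n (nat \<lfloor>real n powr \<alpha>\<rfloor>)) {x. good n x}) \<longlonglongrightarrow> 1"
      using \<delta>_small by blast
    then show "\<exists>\<delta> :: nat \<Rightarrow> nat \<Rightarrow> real.
      (\<forall>c\<ge>1. superpoly_small (\<delta> c)) \<and>
      (\<lambda>n. measure_pmf.prob (planted_clique n (nat \<lfloor>real n powr \<alpha>\<rfloor>))
         {(E, PC). \<forall>C\<in>cliques n E. real (card C) \<le> \<theta> * log 2 (real n) \<longrightarrow>
            (\<forall>c\<ge>1. 1 - reach_prob (metropolis n E (\<beta> n)) C (n ^ c)
               {C'. real (card C') \<ge> (1 + \<epsilon>) * log 2 (real n) \<or>
                    real (card (C' \<inter> PC)) \<ge> \<gamma> * log 2 (real n)}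
             \<ge> 1 - \<delta> c n)}) \<longlonglongrightarrow> 1"
      unfolding good_def by blast
  qed
qed

end
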